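(* For any $0<p<1/2$ there exist constants $c$, $\gamma_0$ and $d_0$ such that for $\gamma\ge\gamma_0$ and $d\ge d_0$, if $A$ is a random matrix with $A^\top\sim\mathrm{ABC}_p(n,\gamma,d)$, then with probability $1-o(1)$ as $n\to\infty$, $$\frac1n\min_{w}|Aw-\mathbbm{1}|_2^2\ \le\ p^{\,\gamma d+c\log_p(\gamma d)}.$$
   Context: $\mathbbm{1}$ is the all-ones vector in $\mathbb{R}^n$, and the minimum is over real vectors $w$ of the appropriate dimension. $\mathrm{ABC}(n,\gamma,d)$ is the distribution on matrices $A_0\in\{0,1\}^{\gamma n\times n}$ obtained as follows: create $\gamma n$ row-nodes with $d$ half-edges each and $n$ column-nodes with $\gamma d$ half-edges each; pair the $\gamma dn$ row half-edges with the $\gamma dn$ column half-edges by a uniformly random permutation; set $(A_0)_{ij}=1$ iff there is at least one edge from row-node $i$ to column-node $j$. $\mathrm{ABC}_p(n,\gamma,d)$ is the distribution of the submatrix of $A_0\sim\mathrm{ABC}(n,\gamma,d)$ consisting of its first $\gamma n(1-p)$ rows. (Parameters are such that these quantities are integers; $p,\gamma,d$ are fixed.) *)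

theory Defs
  imports
    "HOL-Probability.Probability"
    "HOL-Combinatorics.Permutations"
    "Jordan_Normal_Form.Matrix"
begin

unbundle no vec_syntax and no inner_syntax

(* Row half-edge h belongs to row-node h div d and column half-edge h to column-node h div k, so that
   every row-node owns d half-edges and every column-node owns k of them.
   This uses r * d = n * k, and the pairing f permutes {..<r * d}. *)
definition abc_matrix :: "nat \<Rightarrow> nat \<Rightarrow> nat \<Rightarrow> nat \<Rightarrow> (nat \<Rightarrow> nat) \<Rightarrow> real mat" where
  "abc_matrix r n d k f =
     mat r n (\<lambda>(i, j). if \<exists>h < r * d. h div d = i \<and> f h div k = j then 1 else 0)"

(* The roundings here and in ABC_p are exact under ABC_params. *)
definition ABC :: "nat \<Rightarrow> real \<Rightarrow> nat \<Rightarrow> real mat pmf" where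
  "ABC n \<gamma> d =
     (let r = nat \<lfloor>\<gamma> * real n\<rfloor>; k = nat \<lfloor>\<gamma> * real d\<rfloor>
      in map_pmf (abc_matrix r n d k) (pmf_of_set {f. f permutes {..<r * d}}))"

definition first_rows :: "nat \<Rightarrow> 'a mat \<Rightarrow> 'a mat" where
  "first_rows m A = mat m (dim_col A) (\<lambda>(i, j). A $$ (i, j))"

definition ABC_p :: "real \<Rightarrow> nat \<Rightarrow> real \<Rightarrow> nat \<Rightarrow> real mat pmf" where
  "ABC_p p n \<gamma> d = map_pmf (first_rows (nat \<lfloor>\<gamma> * real n * (1 - p)\<rfloor>)) (ABC n \<gamma> d)"

definition ABC_params :: "real \<Rightarrow> nat \<Rightarrow> real \<Rightarrow> nat \<Rightarrow> bool" where
  "ABC_params p n \<gamma> d \<longleftrightarrow>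
     \<gamma> * real n \<in> \<nat> \<and> \<gamma> * real d \<in> \<nat> \<and> \<gamma> * real n * (1 - p) \<in> \<nat>"

definition ones_vec :: "nat \<Rightarrow> real Matrix.vec" where
  "ones_vec n = Matrix.vec n (\<lambda>_. 1)"

definition l2_sq :: "real Matrix.vec \<Rightarrow> real" where
  "l2_sq v = (\<Sum>i<dim_vec v. (v $ i)\<^sup>2)"

(* The infimum is a minimum: see min_residual_attained. *)
definition min_residual :: "real mat \<Rightarrow> real" where
  "min_residual A = (INF w \<in> carrier_vec (dim_col A). l2_sq (A *\<^sub>v w - ones_vec (dim_row A)))"

(* Orthogonal residual of g with respect to the first m functions v, for the
   inner product on functions restricted to {..<n}. *)
lemma orthogonal_residual_exists:
  fixes v :: "nat \<Rightarrow> nat \<Rightarrow> real"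
  shows "\<exists>w. \<forall>j<m. (\<Sum>i<n. (g i - (\<Sum>l<m. w l * v l i)) * v j i) = 0"
proof (induction m arbitrary: g)
  case 0
  show ?case by simp
next
  case (Suc m)
  obtain a where a: "\<forall>j<m. (\<Sum>i<n. (g i - (\<Sum>l<m. a l * v l i)) * v j i) = 0"
    using Suc.IH by blast
  obtain b where b: "\<forall>j<m. (\<Sum>i<n. (v m i - (\<Sum>l<m. b l * v l i)) * v j i) = 0"
    using Suc.IH by blast
  define r where "r i = g i - (\<Sum>l<m. a l * v l i)" for i
  define u where "u i = v m i - (\<Sum>l<m. b l * v l i)" for i
  have ra: "(\<Sum>i<n. r i * v j i) = 0" if "j < m" for j
    using a that by (simp add: r_def)
  have ub: "(\<Sum>i<n. u i * v j i) = 0" if "j < m" for j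
    using b that by (simp add: u_def)
  have orth: "(\<Sum>i<n. x i * (\<Sum>l<m. b l * v l i)) = 0"
    if "\<And>j. j < m \<Longrightarrow> (\<Sum>i<n. x i * v j i) = 0" for x
  proof -
    have "(\<Sum>i<n. x i * (\<Sum>l<m. b l * v l i)) = (\<Sum>i<n. \<Sum>l<m. b l * (x i * v l i))"
      by (simp add: sum_distrib_left mult_ac)
    also have "\<dots> = (\<Sum>l<m. b l * (\<Sum>i<n. x i * v l i))"
      by (subst sum.swap) (simp add: sum_distrib_left)
    also have "\<dots> = 0" using that by simp
    finally show ?thesis .
  qed
  have vm: "v m i = u i + (\<Sum>l<m. b l * v l i)" for i by (simp add: u_def)
  have rv: "(\<Sum>i<n. r i * v m i) = (\<Sum>i<n. r i * u i)"
    using orth[of r, OF ra] by (simp add: vm distrib_left sum.distrib)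
  have uv: "(\<Sum>i<n. u i * v m i) = (\<Sum>i<n. u i * u i)"
    using orth[of u, OF ub] by (simp add: vm distrib_left sum.distrib)
  define t where "t = (\<Sum>i<n. r i * u i) / (\<Sum>i<n. u i * u i)"
  have tt: "(\<Sum>i<n. r i * u i) = t * (\<Sum>i<n. u i * u i)"
  proof (cases "(\<Sum>i<n. u i * u i) = 0")
    case True
    then have "\<forall>i<n. u i = 0" by (subst (asm) sum_nonneg_eq_0_iff) auto
    then show ?thesis by simp
  qed (simp add: t_def)
  define w where "w l = (if l = m then t else a l - t * b l)" for l
  have res: "g i - (\<Sum>l<Suc m. w l * v l i) = r i - t * u i" for i
    by (simp add: w_def r_def u_def sum_subtractf left_diff_distrib sum_distrib_left
        right_diff_distrib mult_ac)
  have "(\<Sum>i<n. (r i - t * u i) * v j i) = 0" if "j < Suc m" for j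
  proof -
    have "(\<Sum>i<n. (r i - t * u i) * v j i)
        = (\<Sum>i<n. r i * v j i) - t * (\<Sum>i<n. u i * v j i)"
      by (simp add: left_diff_distrib sum_subtractf sum_distrib_left mult.assoc)
    also have "\<dots> = 0"
      using that ra ub rv uv tt by (cases "j = m") auto
    finally show ?thesis .
  qed
  then show ?case unfolding res[symmetric] by blast
qed

lemma min_residual_attained:
  "\<exists>w \<in> carrier_vec (dim_col A). l2_sq (A *\<^sub>v w - ones_vec (dim_row A)) = min_residual A"
proof -
  let ?n = "dim_row A" and ?m = "dim_col A"
  let ?f = "\<lambda>w. l2_sq (A *\<^sub>v w - ones_vec ?n)"
  define e where "e x i = 1 - (\<Sum>l<?m. x l * A $$ (i, l))" for x i
  obtain a where a: "\<forall>j<?m. (\<Sum>i<?n. e a i * A $$ (i, j)) = 0"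
    using orthogonal_residual_exists[where m = ?m and n = ?n and g = "\<lambda>_. 1"
        and v = "\<lambda>l i. A $$ (i, l)"]
    unfolding e_def by blast
  have f: "?f w = (\<Sum>i<?n. (e (\<lambda>l. w $ l) i)\<^sup>2)" if "w \<in> carrier_vec ?m" for w
    using that
    by (auto simp: l2_sq_def ones_vec_def e_def scalar_prod_def atLeast0LessThan mult.commute
        power2_commute intro!: sum.cong)
  have le: "(\<Sum>i<?n. (e a i)\<^sup>2) \<le> (\<Sum>i<?n. (e x i)\<^sup>2)" for x
  proof -
    define s where "s i = (\<Sum>l<?m. (a l - x l) * A $$ (i, l))" for i
    have ex: "e x i = e a i + s i" for i
      by (simp add: e_def s_def left_diff_distrib sum_subtractf)
    have "(\<Sum>i<?n. e a i * s i) = (\<Sum>i<?n. \<Sum>l<?m. (a l - x l) * (e a i * A $$ (i, l)))"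
      by (simp add: s_def sum_distrib_left mult_ac)
    also have "\<dots> = (\<Sum>l<?m. (a l - x l) * (\<Sum>i<?n. e a i * A $$ (i, l)))"
      by (subst sum.swap) (simp add: sum_distrib_left)
    also have "\<dots> = 0" using a by simp
    finally have z: "(\<Sum>i<?n. e a i * s i) = 0" .
    have "(\<Sum>i<?n. (e x i)\<^sup>2)
        = (\<Sum>i<?n. (e a i)\<^sup>2) + (\<Sum>i<?n. (s i)\<^sup>2) + 2 * (\<Sum>i<?n. e a i * s i)"
      by (simp add: ex power2_sum sum.distrib sum_distrib_left mult_ac)
    with z show ?thesis by (simp add: sum_nonneg)
  qed
  define w where "w = Matrix.vec ?m a"
  have wc: "w \<in> carrier_vec ?m" by (simp add: w_def)
  have ew: "e (\<lambda>l. w $ l) = e a" by (auto simp: e_def w_def)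
  have min: "?f w \<le> ?f y" if "y \<in> carrier_vec ?m" for y
    using f[OF wc] f[OF that] le ew by simp
  have "min_residual A = ?f w"
    unfolding min_residual_def using wc min by (intro cInf_eq_minimum) auto
  with wc show ?thesis by metis
qed

end

theory Submission
  imports Defs "HOL-Real_Asymp.Real_Asymp"
begin

text \<open>
Write \<open>k = \<gamma> d\<close>, \<open>r = \<gamma> n\<close>, \<open>m = (1 - p) r\<close> and \<open>N = r d = n k\<close>. The constant \<open>c = 1\<close> works, so the
bound to prove is \<open>min_residual A \<le> n k p\<^sup>k\<close> with high probability.

The optimal error vector \<open>x\<close> is the projection of the all-ones vector onto the kernel of \<open>A\<^sup>T\<close>, and
therefore \<open>|x|\<^sup>2\<close> equals the sum of its entries and is at most the size of its support
(\<open>min_residual_le_support\<close>). It remains to show that no vector that is orthogonal to all \<open>m\<close> rows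
has a support of size more than \<open>n k p\<^sup>k\<close>. Two arguments cover two ranges of the support size.

Supports of size at least about \<open>n / (64 d)\<close>. Expose the first \<open>1300 n\<close> rows one at a time and follow
the space \<open>K\<close> of vectors orthogonal to the rows seen so far. If \<open>K\<close> contains a vector \<open>x\<close> with that
large a support, then the next row fails to be orthogonal to \<open>x\<close> with probability at least \<open>1 / 325\<close>
(\<open>row_anticoncentration\<close>), and then the dimension of \<open>K\<close> drops. It starts at \<open>n\<close> and cannot drop
more often than \<open>n\<close> times, so \<open>2 ^ dim K\<close>, restricted to the event that such an \<open>x\<close> still exists, is
a supermartingale that decays exponentially (\<open>kernel_potential_step\<close>). The argument needs that the
half-edges of no set of \<open>n / (64 d)\<close> columns are used up by the rows exposed before; this is a union
bound (\<open>depleted_set_count\<close>).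

Smaller supports. The support \<open>T\<close> of a kernel vector is a stopping set: no row meets \<open>T\<close> in exactly
one column. So the half-edges of \<open>T\<close> that are matched to the \<open>m\<close> surviving rows hit each row that
they hit at least twice, while for a small \<open>T\<close> they should mostly hit different rows. With
\<open>\<theta> = |T| / n\<close> this has probability at most \<open>((p + 2 sqrt (\<theta> d)) / (1 - \<theta>)) ^ (k |T|)\<close>
(\<open>stopping_set_count\<close>), to be compared with the at most \<open>(e / \<theta>) ^ |T|\<close> sets of this size. For
\<open>\<theta> \<ge> k p\<^sup>k\<close> the union bound wins: the power of \<open>p\<close> in the \<open>k\<close>-th power of the base is paid by
\<open>\<theta>\<close>, and the factor \<open>k\<close> absorbs all constants (\<open>stopping_rate\<close>).

All three probability estimates are potential arguments for a uniform permutation whose values are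
revealed one by one; \<open>perm_resample\<close> is the exchangeability behind them.
\<close>

section \<open>Sampling a uniform permutation one value at a time\<close>

text \<open>
Exchanging the values \<open>f h\<close> and \<open>y\<close> by a transposition is an involution on the pairs \<open>(f, y)\<close> with
\<open>y\<close> in \<open>S - f ` H\<close>; it keeps \<open>f\<close> on \<open>H\<close> and moves \<open>y\<close> to the argument \<open>h\<close>. So, given the values of
\<open>f\<close> on \<open>H\<close>, the value \<open>f h\<close> is uniform on what is left of \<open>S\<close>. As \<open>\<Phi>\<close> only looks at \<open>insert h H\<close>,
its value after the exchange is its value at \<open>f(h := y)\<close>, which need not be a permutation.
\<close>

lemma perm_resample:
  fixes \<Phi> :: "('a \<Rightarrow> 'a) \<Rightarrow> real"
  assumes S: "finite S" "H \<subseteq> S" "h \<in> S" "h \<notin> H"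
    and loc: "\<And>f g. (\<And>a. a \<in> insert h H \<Longrightarrow> f a = g a) \<Longrightarrow> \<Phi> f = \<Phi> g"
  shows "real (card S - card H) * (\<Sum>f | f permutes S. \<Phi> f)
       = (\<Sum>f | f permutes S. \<Sum>y\<in>S - f ` H. \<Phi> (f(h := y)))"
proof -
  let ?P = "{f. f permutes S}"
  let ?Q = "Sigma ?P (\<lambda>f. S - f ` H)"
  define t where "t = (\<lambda>(f :: 'a \<Rightarrow> 'a, y). (Transposition.transpose (f h) y \<circ> f, f h))"
  have fin: "finite ?P" using S(1) by (rule finite_permutations)
  have agree: "(Transposition.transpose (f h) y \<circ> f) a = f a"
    if "f permutes S" "y \<in> S - f ` H" "a \<in> H" for f y a
  proof -
    have "f a \<noteq> f h" using permutes_inj[OF that(1)] that(3) S(4) by (auto dest: injD)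
    moreover have "f a \<noteq> y" using that by auto
    ultimately show ?thesis by (simp add: transpose_def)
  qed
  have t_in: "t z \<in> ?Q" if "z \<in> ?Q" for z
  proof -
    obtain f y where z: "z = (f, y)" "f permutes S" "y \<in> S - f ` H" using \<open>z \<in> ?Q\<close> by auto
    have "f h \<in> S" using z(2) S(3) by (simp add: permutes_in_image)
    then have "(Transposition.transpose (f h) y \<circ> f) permutes S"
      using z by (intro permutes_compose permutes_swap_id) auto
    moreover have "(Transposition.transpose (f h) y \<circ> f) ` H = f ` H"
      using agree[OF z(2,3)] by (intro image_cong) auto
    moreover have "f h \<notin> f ` H" using permutes_inj[OF z(2)] S(4) by (auto dest: injD)
    ultimately show ?thesis using z(1) \<open>f h \<in> S\<close> by (simp add: t_def)
  qed
  have t_t: "t (t z) = z" for z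
    by (cases z) (auto simp: t_def fun_eq_iff transpose_commute)
  have t_val: "\<Phi> (fst (t (f, y))) = \<Phi> (f(h := y))" if "f permutes S" "y \<in> S - f ` H" for f y
    using agree[OF that] by (intro loc) (auto simp: t_def)
  have "(\<Sum>f\<in>?P. \<Sum>y\<in>S - f ` H. \<Phi> (f(h := y))) = (\<Sum>(f, y)\<in>?Q. \<Phi> (f(h := y)))"
    using fin S(1) by (subst sum.Sigma) auto
  also have "\<dots> = (\<Sum>z\<in>?Q. \<Phi> (fst z))"
  proof (rule sum.reindex_bij_witness[where i = t and j = t], goal_cases)
    case (5 z)
    then show ?case using t_val[of "fst z" "snd z"] by (cases z) auto
  qed (use t_t t_in in auto)
  also have "\<dots> = (\<Sum>f\<in>?P. \<Sum>y\<in>S - f ` H. \<Phi> f)"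
    using fin S(1) by (subst sum.Sigma) (auto simp: case_prod_beta)
  also have "\<dots> = (\<Sum>f\<in>?P. real (card S - card H) * \<Phi> f)"
  proof (rule sum.cong[OF refl])
    fix f assume "f \<in> ?P"
    then have f: "f permutes S" by simp
    have "f ` H \<subseteq> S" using f S(2) by (metis image_mono permutes_image)
    moreover have "card (f ` H) = card H"
      using f by (intro card_image) (meson inj_on_subset permutes_inj subset_UNIV)
    moreover have "finite (f ` H)" using S(1,2) by (meson finite_imageI finite_subset)
    ultimately show "(\<Sum>y\<in>S - f ` H. \<Phi> f) = real (card S - card H) * \<Phi> f"
      by (simp add: card_Diff_subset)
  qed
  finally show ?thesis by (simp add: sum_distrib_left)
qed

text \<open>
The form in which resampling is used: \<open>\<Psi>\<close> is a potential before and \<open>\<Phi>\<close> the one after revealing the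
value at \<open>h\<close>, and a bound on the conditional expectation of \<open>\<Phi>\<close> gives a bound on the mean.
\<close>

lemma perm_step:
  fixes \<Phi> \<Psi> :: "('a \<Rightarrow> 'a) \<Rightarrow> real"
  assumes S: "finite S" "H \<subseteq> S" "h \<in> S" "h \<notin> H"
    and loc: "\<And>f g. (\<And>a. a \<in> insert h H \<Longrightarrow> f a = g a) \<Longrightarrow> \<Phi> f = \<Phi> g"
    and step: "\<And>f. f permutes S \<Longrightarrow>
      (\<Sum>y\<in>S - f ` H. \<Phi> (f(h := y))) \<le> c * real (card S - card H) * \<Psi> f"
  shows "(\<Sum>f | f permutes S. \<Phi> f) \<le> c * (\<Sum>f | f permutes S. \<Psi> f)"
proof -
  have "card H < card S" using S by (intro psubset_card_mono) auto
  then have pos: "real (card S - card H) > 0" by simp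
  have "real (card S - card H) * (\<Sum>f | f permutes S. \<Phi> f)
      = (\<Sum>f | f permutes S. \<Sum>y\<in>S - f ` H. \<Phi> (f(h := y)))"
    by (rule perm_resample[OF S]) (rule loc)
  also have "\<dots> \<le> (\<Sum>f | f permutes S. c * real (card S - card H) * \<Psi> f)"
    using step by (intro sum_mono) auto
  also have "\<dots> = real (card S - card H) * (c * (\<Sum>f | f permutes S. \<Psi> f))"
    by (simp add: sum_distrib_left mult_ac)
  finally show ?thesis using pos by (simp add: mult_le_cancel_left_pos)
qed

text \<open>
Iteration of the step over all of \<open>H\<close>. The number of values still available is bounded below by
its final value, which costs only a factor close to 1 when \<open>H\<close> is a small part of \<open>S\<close>.
\<close>

lemma perm_potential:
  fixes \<Phi> :: "'a set \<Rightarrow> ('a \<Rightarrow> 'a) \<Rightarrow> real"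
  assumes S: "finite S" "H \<subseteq> S" "card H < card S"
    and nonneg: "\<And>G f. 0 \<le> \<Phi> G f" "0 \<le> C"
    and loc: "\<And>G f g. (\<And>a. a \<in> G \<Longrightarrow> f a = g a) \<Longrightarrow> \<Phi> G f = \<Phi> G g"
    and step: "\<And>G h f. G \<subseteq> H \<Longrightarrow> h \<in> H - G \<Longrightarrow> f permutes S \<Longrightarrow>
      (\<Sum>y\<in>S - f ` G. \<Phi> (insert h G) (f(h := y))) \<le> C * \<Phi> G f"
  shows "(\<Sum>f | f permutes S. \<Phi> H f)
       \<le> (C / real (card S - card H)) ^ card H * (\<Sum>f | f permutes S. \<Phi> {} f)"
proof -
  have finH: "finite H" using S finite_subset by blast
  have "G \<subseteq> H \<longrightarrow> (\<Sum>f | f permutes S. \<Phi> G f)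
       \<le> (C / real (card S - card H)) ^ card G * (\<Sum>f | f permutes S. \<Phi> {} f)" if "finite G" for G
    using that
  proof (induction G rule: finite_induct)
    case (insert h G)
    let ?c = "C / real (card S - card H)"
    have c0: "?c \<ge> 0" using nonneg(2) by simp
    show ?case
    proof
      assume sub: "insert h G \<subseteq> H"
      have cG: "card G \<le> card H" using sub finH by (auto intro: card_mono)
      have cc: "C \<le> ?c * real (card S - card G)"
        using S(3) cG nonneg(2) by (auto simp: field_simps intro: mult_left_mono)
      have "(\<Sum>f | f permutes S. \<Phi> (insert h G) f) \<le> ?c * (\<Sum>f | f permutes S. \<Phi> G f)"
      proof (rule perm_step[of S G h])
        fix f assume "f permutes S"
        then have "(\<Sum>y\<in>S - f ` G. \<Phi> (insert h G) (f(h := y))) \<le> C * \<Phi> G f"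
          using sub insert by (intro step) auto
        also have "\<dots> \<le> ?c * real (card S - card G) * \<Phi> G f"
          using cc nonneg by (intro mult_right_mono) auto
        finally show "(\<Sum>y\<in>S - f ` G. \<Phi> (insert h G) (f(h := y)))
            \<le> ?c * real (card S - card G) * \<Phi> G f" .
      next
        fix f g :: "'a \<Rightarrow> 'a" assume "\<And>a. a \<in> insert h G \<Longrightarrow> f a = g a"
        then show "\<Phi> (insert h G) f = \<Phi> (insert h G) g" by (rule loc)
      qed (use S(1,2) sub insert.hyps in auto)
      also have "\<dots> \<le> ?c * (?c ^ card G * (\<Sum>f | f permutes S. \<Phi> {} f))"
        using insert sub c0 by (intro mult_left_mono) auto
      finally show "(\<Sum>f | f permutes S. \<Phi> (insert h G) f)
          \<le> ?c ^ card (insert h G) * (\<Sum>f | f permutes S. \<Phi> {} f)"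
        using insert by simp
    qed
  qed simp
  then show ?thesis using finH by simp
qed

section \<open>Coordinates that determine a space of vectors\<close>

definition fun_subspace :: "('a \<Rightarrow> real) set \<Rightarrow> bool" where
  "fun_subspace K \<longleftrightarrow> (\<forall>x\<in>K. \<forall>y\<in>K. \<forall>a. (\<lambda>j. x j + a * y j) \<in> K)"

definition determines :: "'a set \<Rightarrow> ('a \<Rightarrow> real) set \<Rightarrow> bool" where
  "determines F K \<longleftrightarrow> (\<forall>x\<in>K. (\<forall>j\<in>F. x j = 0) \<longrightarrow> (\<forall>j. x j = 0))"

text \<open>
For a subspace this is the dimension; this form of it needs no bases.
\<close>

definition fun_dim :: "('a \<Rightarrow> real) set \<Rightarrow> nat" where
  "fun_dim K = (LEAST r. \<exists>F. finite F \<and> card F = r \<and> determines F K)"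

lemma fun_dim_le: "finite F \<Longrightarrow> determines F K \<Longrightarrow> fun_dim K \<le> card F"
  unfolding fun_dim_def by (intro Least_le) auto

lemma fun_dim_attained:
  assumes "finite F" "determines F K"
  obtains G where "finite G" "card G = fun_dim K" "determines G K"
proof -
  have "\<exists>r G. finite G \<and> card G = r \<and> determines G K" using assms by blast
  from LeastI_ex[OF this] show ?thesis using that unfolding fun_dim_def by blast
qed

lemma fun_dim_mono:
  assumes "finite F" "determines F K" "K' \<subseteq> K"
  shows "fun_dim K' \<le> fun_dim K"
proof -
  obtain G where "finite G" "card G = fun_dim K" "determines G K"
    using fun_dim_attained assms by metis
  then show ?thesis using fun_dim_le[of G K'] assms(3) by (auto simp: determines_def)
qed

text \<open>
A set \<open>G\<close> of determining coordinates of least size is independent: leaving out any \<open>j\<close> admits a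
vector that vanishes on \<open>G\<close> except at \<open>j\<close>. So \<open>K\<close> has a basis dual to \<open>G\<close>. A functional that does
not vanish on \<open>K\<close> does not vanish at the basis vector of some \<open>j\<close>, and then \<open>j\<close> can be left out on
its kernel.
\<close>

lemma fun_dim_kernel_less:
  fixes K :: "('a \<Rightarrow> real) set"
  assumes K: "fun_subspace K" and fin: "finite F" "determines F K"
    and J: "x \<in> K" "sum x J \<noteq> 0"
  shows "fun_dim {x \<in> K. sum x J = 0} < fun_dim K"
proof -
  obtain G where G: "finite G" "card G = fun_dim K" "determines G K"
    using fun_dim_attained[OF fin] by metis
  have "\<exists>y\<in>K. (\<forall>i\<in>G - {j}. y i = 0) \<and> y j = 1" if "j \<in> G" for j
  proof -
    have "\<not> determines (G - {j}) K"
      using fun_dim_le[of "G - {j}" K] G(1,2) that card_Diff1_less[OF G(1) that] by auto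
    then obtain y where y: "y \<in> K" "\<forall>i\<in>G - {j}. y i = 0" "\<exists>i. y i \<noteq> 0"
      by (auto simp: determines_def)
    have yj: "y j \<noteq> 0" using y G(3) unfolding determines_def by blast
    have "(\<lambda>i. y i + (1 / y j - 1) * y i) \<in> K" using K y(1) by (auto simp: fun_subspace_def)
    then show ?thesis using y(2) yj by (intro bexI) (auto simp: field_simps)
  qed
  then obtain b where b: "\<And>j. j \<in> G \<Longrightarrow> b j \<in> K" "\<And>i j. j \<in> G \<Longrightarrow> i \<in> G \<Longrightarrow> i \<noteq> j \<Longrightarrow> b j i = 0"
    "\<And>j. j \<in> G \<Longrightarrow> b j j = 1"
    by (metis Diff_iff singletonD)
  have sub: "(\<lambda>i. x i - (\<Sum>j\<in>G'. x j * b j i)) \<in> K" if "x \<in> K" "finite G'" "G' \<subseteq> G" for x G'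
    using that(2,3)
  proof (induction G' rule: finite_induct)
    case (insert j G')
    have "(\<lambda>i. (x i - (\<Sum>j\<in>G'. x j * b j i)) + (- x j) * b j i) \<in> K"
      using K[unfolded fun_subspace_def, rule_format, of "\<lambda>i. x i - (\<Sum>j\<in>G'. x j * b j i)" "b j" "- x j"]
        insert b(1)[of j] by simp
    then show ?case using insert by (simp add: algebra_simps)
  qed (use that in simp)
  have expand: "x i = (\<Sum>j\<in>G. x j * b j i)" if "x \<in> K" for x i
  proof -
    have on_G: "(\<Sum>j\<in>G. x j * b j g) = x g" if "g \<in> G" for g
    proof -
      have "(\<Sum>j\<in>G. x j * b j g) = (\<Sum>j\<in>{g}. x j * b j g)"
        using G(1) that b(2) by (intro sum.mono_neutral_right) auto
      then show ?thesis using b(3) that by simp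
    qed
    have "x i - (\<Sum>j\<in>G. x j * b j i) = 0"
      by (rule G(3)[unfolded determines_def, rule_format, OF sub[OF that G(1) order_refl]])
        (simp add: on_G)
    then show ?thesis by simp
  qed
  have "\<exists>j\<in>G. sum (b j) J \<noteq> 0"
  proof (rule ccontr)
    assume "\<not> (\<exists>j\<in>G. sum (b j) J \<noteq> 0)"
    then have z: "\<forall>j\<in>G. sum (b j) J = 0" by blast
    have "sum x J = (\<Sum>i\<in>J. \<Sum>j\<in>G. x j * b j i)" by (intro sum.cong[OF refl] expand[OF J(1)])
    also have "\<dots> = (\<Sum>j\<in>G. x j * sum (b j) J)" by (subst sum.swap) (simp add: sum_distrib_left)
    also have "\<dots> = 0" using z by simp
    finally show False using J(2) by simp
  qed
  then obtain j where j: "j \<in> G" "sum (b j) J \<noteq> 0" by blast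
  have "determines (G - {j}) {x \<in> K. sum x J = 0}"
    unfolding determines_def
  proof (intro ballI impI)
    fix z assume z: "z \<in> {x \<in> K. sum x J = 0}" "\<forall>i\<in>G - {j}. z i = 0"
    have zi: "z i = z j * b j i" for i
    proof -
      have "z i = (\<Sum>l\<in>G. z l * b l i)" using expand z by blast
      also have "\<dots> = (\<Sum>l\<in>{j}. z l * b l i)" using z(2) G(1) j(1) by (intro sum.mono_neutral_right) auto
      finally show ?thesis by simp
    qed
    have "sum z J = (\<Sum>i\<in>J. z j * b j i)" by (intro sum.cong[OF refl] zi)
    then have "z j * sum (b j) J = 0" using z(1) by (simp add: sum_distrib_left)
    then have "z j = 0" using j(2) by simp
    then show "\<forall>i. z i = 0" by (metis zi mult_zero_left)
  qed
  then have "fun_dim {x \<in> K. sum x J = 0} \<le> card (G - {j})" using G(1) by (intro fun_dim_le) auto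
  then show ?thesis using G j(1) card_Diff1_less[of G j] by simp
qed

section \<open>The residual is at most a support size\<close>

text \<open>
The vector is \<open>x = 1 - A w\<close> for an optimal \<open>w\<close>. It is orthogonal to \<open>A w\<close>, so \<open>|x|\<^sup>2\<close> is the sum of its
entries; with \<open>\<Sum> (x i - 1)\<^sup>2 \<ge> 0\<close> over the support this gives \<open>|x|\<^sup>2 \<le> card s\<close>.
\<close>

lemma min_residual_le_support:
  "\<exists>x. (\<forall>j<dim_col A. (\<Sum>i<dim_row A. x i * A $$ (i, j)) = 0)
     \<and> (\<forall>i\<ge>dim_row A. x i = 0) \<and> min_residual A \<le> real (card {i. x i \<noteq> 0})"
proof -
  let ?n = "dim_row A" and ?m = "dim_col A"
  obtain w where w: "\<forall>j<?m. (\<Sum>i<?n. (1 - (\<Sum>l<?m. w l * A $$ (i, l))) * A $$ (i, j)) = 0"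
    using orthogonal_residual_exists[where m = ?m and n = ?n and g = "\<lambda>_. 1"
        and v = "\<lambda>l i. A $$ (i, l)"] by blast
  define x where "x i = (if i < ?n then 1 - (\<Sum>l<?m. w l * A $$ (i, l)) else 0)" for i
  define s where "s = {i. x i \<noteq> 0}"
  have s: "s \<subseteq> {..<?n}" by (auto simp: s_def x_def split: if_splits)
  have orth: "(\<Sum>i<?n. x i * A $$ (i, j)) = 0" if "j < ?m" for j
    using w that by (simp add: x_def)
  have "min_residual A \<le> l2_sq (A *\<^sub>v Matrix.vec ?m w - ones_vec ?n)"
    unfolding min_residual_def
    by (rule cINF_lower) (auto intro!: bdd_belowI[of _ 0] simp: l2_sq_def sum_nonneg)
  also have "\<dots> = (\<Sum>i<?n. (x i)\<^sup>2)"
    by (auto simp: l2_sq_def ones_vec_def x_def scalar_prod_def atLeast0LessThan mult.commute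
        power2_commute intro!: sum.cong)
  finally have le: "min_residual A \<le> (\<Sum>i<?n. (x i)\<^sup>2)" .
  have "(\<Sum>i<?n. x i * (\<Sum>l<?m. w l * A $$ (i, l))) = (\<Sum>l<?m. w l * (\<Sum>i<?n. x i * A $$ (i, l)))"
    by (simp add: sum_distrib_left mult_ac) (subst sum.swap, simp)
  also have "\<dots> = 0" using orth by simp
  finally have "(\<Sum>i<?n. x i * (1 - (\<Sum>l<?m. w l * A $$ (i, l)))) = (\<Sum>i<?n. x i)"
    by (simp add: right_diff_distrib sum_subtractf)
  then have sq: "(\<Sum>i<?n. (x i)\<^sup>2) = (\<Sum>i<?n. x i)"
    by (simp add: x_def power2_eq_square)
  have "(\<Sum>i<?n. x i) = (\<Sum>i\<in>s. x i)" "(\<Sum>i<?n. (x i)\<^sup>2) = (\<Sum>i\<in>s. (x i)\<^sup>2)"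
    using s by (auto intro!: sum.mono_neutral_right simp: s_def)
  moreover have "(\<Sum>i\<in>s. (x i - 1)\<^sup>2) \<ge> 0" by (simp add: sum_nonneg)
  then have "(\<Sum>i\<in>s. (x i)\<^sup>2) - 2 * (\<Sum>i\<in>s. x i) + real (card s) \<ge> 0"
    by (simp add: power2_diff sum.distrib sum_subtractf sum_distrib_left)
  ultimately have "(\<Sum>i<?n. (x i)\<^sup>2) \<le> real (card s)" using sq by simp
  then show ?thesis using orth le by (intro exI[of _ x]) (simp add: s_def x_def)
qed

section \<open>Half-edges and rows\<close>

definition half_edges :: "nat \<Rightarrow> nat set \<Rightarrow> nat set" where
  "half_edges k T = {y. y div k \<in> T}"

text \<open>
Being a set, it counts repeated edges once, as the matrix does.
\<close>

definition row_cols :: "nat \<Rightarrow> nat \<Rightarrow> (nat \<Rightarrow> nat) \<Rightarrow> nat \<Rightarrow> nat set" where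
  "row_cols k d f i = (\<lambda>h. f h div k) ` {i * d..<i * d + d}"

lemma half_edges_eq_image:
  assumes "0 < k"
  shows "half_edges k T = (\<lambda>(j, b). j * k + b) ` (T \<times> {..<k})"
proof -
  have "y \<in> (\<lambda>(j, b). j * k + b) ` (T \<times> {..<k})" if "y div k \<in> T" for y
    using that assms by (intro image_eqI[of _ _ "(y div k, y mod k)"]) auto
  then show ?thesis using assms by (auto simp: half_edges_def)
qed

lemma card_half_edges:
  assumes "0 < k" "finite T"
  shows "finite (half_edges k T)" "card (half_edges k T) = k * card T"
proof -
  have "inj_on (\<lambda>(j, b). j * k + b) (T \<times> {..<k})"
  proof (rule inj_onI, clarify)
    fix j b j' b' assume *: "b < k" "b' < k" and eq: "j * k + b = j' * k + b'"
    have "(j * k + b) div k = j" "(j' * k + b') div k = j'" using * by auto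
    then show "j = j' \<and> b = b'" using eq by simp
  qed
  then show "finite (half_edges k T)" "card (half_edges k T) = k * card T"
    using assms by (simp_all add: half_edges_eq_image card_image)
qed

lemma half_edges_subset:
  assumes "0 < k" "T \<subseteq> {..<n}" shows "half_edges k T \<subseteq> {..<n * k}"
  using assms by (auto simp: half_edges_def div_less_iff_less_mult)

lemma mem_row_range:
  fixes h i d :: nat
  assumes "0 < d"
  shows "h \<in> {i * d..<i * d + d} \<longleftrightarrow> h div d = i"
proof -
  have "h div d = i \<longleftrightarrow> i \<le> h div d \<and> h div d < Suc i" by auto
  also have "\<dots> \<longleftrightarrow> i * d \<le> h \<and> h < Suc i * d"
    using assms by (simp only: less_eq_div_iff_mult_less_eq div_less_iff_less_mult)
  finally show ?thesis by auto
qed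

section \<open>Small stopping sets\<close>

text \<open>
Reveal the partners of the half-edges of \<open>T\<close>, that is, the inverse permutation on them. Each partner
is dead (it belongs to a row with number at least \<open>m\<close>), or it lies in a surviving row that was hit
before, or in a new surviving row. On a stopping set at least half of the surviving partners are
repetitions, so the potential \<open>s ^ (2 * rows hit) / s ^ (surviving partners)\<close> with \<open>s \<le> 1\<close> is at
least 1. A step multiplies it by 1, by \<open>1 / s\<close> and by \<open>s\<close> in the three cases, and there are at most
\<open>N - m d\<close>, \<open>k |T| d\<close> and \<open>N\<close> values of the three kinds.
\<close>

lemma stopping_set_count:
  assumes kd: "0 < k" "0 < d" and s: "0 < s" "s \<le> 1"
    and T: "T \<subseteq> {..<n}" "card T < n" and m: "m * d \<le> n * k"
  shows "real (card {f. f permutes {..<n * k} \<and> (\<forall>i<m. card (row_cols k d f i \<inter> T) \<noteq> 1)})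
    \<le> fact (n * k) * (((real (n * k) - real (m * d)) + real (k * card T) * real d / s + real (n * k) * s)
          / real (n * k - k * card T)) ^ (k * card T)"
proof -
  let ?S = "{..<n * k}" and ?A = "m * d" and ?H = "half_edges k T"
  define L where "L = k * card T"
  have finT: "finite T" using T finite_subset by blast
  have H: "?H \<subseteq> ?S" "card ?H = L" "finite ?H"
    using half_edges_subset[OF kd(1) T(1)] card_half_edges[OF kd(1) finT] by (auto simp: L_def)
  have LN: "L < n * k" using T kd by (simp add: L_def mult.commute)
  define V where "V G f = {v \<in> f ` G. v < ?A}" for G and f :: "nat \<Rightarrow> nat"
  define \<Phi> where "\<Phi> G f = s ^ (2 * card ((\<lambda>v. v div d) ` V G f)) / s ^ card (V G f)" for G f
  define C where "C = (real (n * k) - real ?A) + real L * real d / s + real (n * k) * s"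
  have C0: "0 \<le> C" unfolding C_def
  proof (intro add_nonneg_nonneg)
    show "0 \<le> real (n * k) - real ?A" using m by (simp flip: of_nat_mult)
  qed (use s in auto)
  have \<Phi>0: "0 \<le> \<Phi> G f" for G f using s by (simp add: \<Phi>_def)
  have ge1: "1 \<le> \<Phi> ?H (Hilbert_Choice.inv f)"
    if f: "f permutes ?S" and stop: "\<forall>i<m. card (row_cols k d f i \<inter> T) \<noteq> 1" for f
  proof -
    have V: "V ?H (Hilbert_Choice.inv f) = {v. v < ?A \<and> f v div k \<in> T}"
      using permutes_inverses[OF f] by (auto simp: V_def half_edges_def image_iff)
    then have finV: "finite (V ?H (Hilbert_Choice.inv f))" by simp
    have two: "2 \<le> card {v \<in> V ?H (Hilbert_Choice.inv f). v div d = i}" if i: "i \<in> (\<lambda>v. v div d) ` V ?H (Hilbert_Choice.inv f)" for i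
    proof -
      obtain v where v: "v < ?A" "f v div k \<in> T" "i = v div d" using i V by auto
      have im: "i < m" using v kd by (simp add: div_less_iff_less_mult mult.commute)
      have c: "f v div k \<in> row_cols k d f i \<inter> T"
        using v mem_row_range[OF kd(2), of v i] by (auto simp: row_cols_def)
      have fin: "finite (row_cols k d f i \<inter> T)" by (simp add: row_cols_def)
      have "\<exists>c'\<in>row_cols k d f i \<inter> T. c' \<noteq> f v div k"
      proof (rule ccontr)
        assume "\<not> ?thesis"
        then have "row_cols k d f i \<inter> T = {f v div k}" using c by blast
        then have "card (row_cols k d f i \<inter> T) = 1" by simp
        then show False using stop im by blast
      qed
      then obtain h where h: "h \<in> {i * d..<i * d + d}" "f h div k \<in> T" "f h div k \<noteq> f v div k"
        by (auto simp: row_cols_def)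
      have hi: "h div d = i" using h(1) mem_row_range[OF kd(2)] by blast
      have "h < ?A" using hi im div_less_iff_less_mult[OF kd(2), of h m] by simp
      then have "{v, h} \<subseteq> {v \<in> V ?H (Hilbert_Choice.inv f). v div d = i}"
        unfolding V using v(1,2) v(3)[symmetric] h(2) hi by simp
      moreover have "card {v, h} = 2" using h(3) by (cases "v = h") auto
      ultimately show ?thesis
        using card_mono[of "{w \<in> V ?H (Hilbert_Choice.inv f). w div d = i}" "{v, h}"] finV by simp
    qed
    have "2 * card ((\<lambda>v. v div d) ` V ?H (Hilbert_Choice.inv f)) = (\<Sum>i\<in>(\<lambda>v. v div d) ` V ?H (Hilbert_Choice.inv f). 2)" by simp
    also have "\<dots> \<le> (\<Sum>i\<in>(\<lambda>v. v div d) ` V ?H (Hilbert_Choice.inv f). card {v \<in> V ?H (Hilbert_Choice.inv f). v div d = i})"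
      by (intro sum_mono two)
    also have "\<dots> = card (V ?H (Hilbert_Choice.inv f))"
      using sum.image_gen[OF finV, of "\<lambda>_. 1::nat" "\<lambda>v. v div d"] by simp
    finally have "s ^ card (V ?H (Hilbert_Choice.inv f)) \<le> s ^ (2 * card ((\<lambda>v. v div d) ` V ?H (Hilbert_Choice.inv f)))"
      using s by (intro power_decreasing) auto
    then show ?thesis using s by (simp add: \<Phi>_def)
  qed
  have step: "(\<Sum>y\<in>?S - f ` G. \<Phi> (insert h G) (f(h := y))) \<le> C * \<Phi> G f"
    if G: "G \<subseteq> ?H" "h \<in> ?H - G" for G h f
  proof -
    let ?R = "(\<lambda>v. v div d) ` V G f"
    have finG: "finite G" using G H finite_subset by blast
    have finV: "finite (V G f)" using finG by (simp add: V_def)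
    have "card ?R \<le> card (V G f)" using finV by (rule card_image_le)
    also have "\<dots> \<le> card (f ` G)" using finG by (intro card_mono) (auto simp: V_def)
    also have "\<dots> \<le> card G" using finG by (rule card_image_le)
    also have "\<dots> \<le> L" using G H card_mono[OF H(3), of G] by simp
    finally have R: "card ?R \<le> L" .
    have pt: "\<Phi> (insert h G) (f(h := y))
        \<le> \<Phi> G f * (of_bool (?A \<le> y) + of_bool (y \<in> half_edges d ?R) / s + s)" (is "_ \<le> _ * ?w")
      if y: "y \<in> ?S - f ` G" for y
    proof -
      have "(f(h := y)) ` insert h G = insert y (f ` G)" using G(2) by auto
      then have V': "V (insert h G) (f(h := y)) = (if y < ?A then insert y (V G f) else V G f)"
        by (auto simp: V_def)
      have yV: "y \<notin> V G f" using y by (auto simp: V_def)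
      consider "?A \<le> y" | "y < ?A" "y div d \<in> ?R" | "y < ?A" "y div d \<notin> ?R" by linarith
      then show ?thesis
      proof cases
        case 1
        then have "\<Phi> (insert h G) (f(h := y)) = \<Phi> G f * 1" using V' by (simp add: \<Phi>_def)
        also have "\<dots> \<le> \<Phi> G f * ?w" using 1 s \<Phi>0 by (intro mult_left_mono) auto
        finally show ?thesis .
      next
        case 2
        then have "\<Phi> (insert h G) (f(h := y)) = \<Phi> G f * (1 / s)"
          using V' yV finV s by (simp add: \<Phi>_def insert_absorb)
        also have "\<dots> \<le> \<Phi> G f * ?w"
          using 2 s \<Phi>0 by (intro mult_left_mono) (auto simp: half_edges_def)
        finally show ?thesis .
      next
        case 3
        then have "\<Phi> (insert h G) (f(h := y)) = \<Phi> G f * s"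
          using V' yV finV s by (simp add: \<Phi>_def power_add)
        also have "\<dots> \<le> \<Phi> G f * ?w" using s \<Phi>0 by (intro mult_left_mono) auto
        finally show ?thesis .
      qed
    qed
    have "(\<Sum>y\<in>?S - f ` G. \<Phi> (insert h G) (f(h := y)))
        \<le> (\<Sum>y\<in>?S - f ` G. \<Phi> G f * (of_bool (?A \<le> y) + of_bool (y \<in> half_edges d ?R) / s + s))"
      by (intro sum_mono pt)
    also have "\<dots> \<le> (\<Sum>y\<in>?S. \<Phi> G f * (of_bool (?A \<le> y) + of_bool (y \<in> half_edges d ?R) / s + s))"
      using s \<Phi>0 by (intro sum_mono2) auto
    also have "\<dots> = \<Phi> G f * (real (card {y \<in> ?S. ?A \<le> y})
        + real (card (?S \<inter> half_edges d ?R)) / s + real (n * k) * s)"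
      by (simp add: sum_distrib_left[symmetric] sum.distrib sum_divide_distrib[symmetric] Int_def
          of_bool_def sum.If_cases)
    also have "\<dots> \<le> \<Phi> G f * C"
    proof -
      have "{y \<in> ?S. ?A \<le> y} = {?A..<n * k}" by auto
      then have "real (card {y \<in> ?S. ?A \<le> y}) = real (n * k) - real ?A" using m by simp
      moreover have "card (?S \<inter> half_edges d ?R) \<le> card (half_edges d ?R)"
        using card_half_edges(1)[OF kd(2), of ?R] finV by (intro card_mono) auto
      then have "card (?S \<inter> half_edges d ?R) \<le> L * d"
        using card_half_edges(2)[OF kd(2) finite_imageI[OF finV], of "\<lambda>v. v div d"]
          mult_le_mono2[OF R, of d] by (metis le_trans mult.commute)
      then have "real (card (?S \<inter> half_edges d ?R)) / s \<le> real L * real d / s"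
        using s by (intro divide_right_mono) (auto simp flip: of_nat_mult)
      ultimately show ?thesis
        unfolding C_def by (intro mult_left_mono[OF _ \<Phi>0] add_mono) auto
    qed
    finally show ?thesis by (simp add: mult.commute)
  qed
  have loc: "\<Phi> G f = \<Phi> G g" if "\<And>a. a \<in> G \<Longrightarrow> f a = g a" for G f g
  proof -
    have "f ` G = g ` G" using that by (intro image_cong) auto
    then show ?thesis by (simp add: \<Phi>_def V_def)
  qed
  let ?P = "{f. f permutes ?S}"
  have finP: "finite ?P" by (simp add: finite_permutations)
  have "real (card {f. f permutes ?S \<and> (\<forall>i<m. card (row_cols k d f i \<inter> T) \<noteq> 1)})
      = (\<Sum>f\<in>{f. f permutes ?S \<and> (\<forall>i<m. card (row_cols k d f i \<inter> T) \<noteq> 1)}. 1)" by simp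
  also have "\<dots> \<le> (\<Sum>f\<in>{f. f permutes ?S \<and> (\<forall>i<m. card (row_cols k d f i \<inter> T) \<noteq> 1)}. \<Phi> ?H (Hilbert_Choice.inv f))"
    using ge1 by (intro sum_mono) auto
  also have "\<dots> \<le> (\<Sum>f\<in>?P. \<Phi> ?H (Hilbert_Choice.inv f))" using finP \<Phi>0 by (intro sum_mono2) auto
  also have "\<dots> = (\<Sum>f\<in>?P. \<Phi> ?H f)"
    by (rule sum.reindex_bij_witness[where i = Hilbert_Choice.inv and j = Hilbert_Choice.inv])
      (auto simp: permutes_inv permutes_inv_inv)
  also have "\<dots> \<le> (C / real (card ?S - card ?H)) ^ card ?H * (\<Sum>f\<in>?P. \<Phi> {} f)"
  proof (rule perm_potential)
    fix G :: "nat set" and f g :: "nat \<Rightarrow> nat" assume "\<And>a. a \<in> G \<Longrightarrow> f a = g a" then show "\<Phi> G f = \<Phi> G g" by (rule loc)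
  next
    fix G h f assume "G \<subseteq> ?H" "h \<in> ?H - G"
    then show "(\<Sum>y\<in>?S - f ` G. \<Phi> (insert h G) (f(h := y))) \<le> C * \<Phi> G f" by (rule step)
  qed (use H LN \<Phi>0 C0 in auto)
  also have "(\<Sum>f\<in>?P. \<Phi> {} f) = fact (n * k)"
    using card_permutations[of ?S "n * k"] by (simp add: \<Phi>_def V_def)
  finally show ?thesis using H by (simp add: C_def L_def mult_ac)
qed

text \<open>
An exponential moment: the potential is 64 to the power of the number of half-edges of \<open>T\<close> that are
matched below \<open>B\<close>. As at most a fraction \<open>1 / 64\<close> of all half-edges lies below \<open>B\<close>, a step multiplies it
by at most 2 on average, and by at most 4 after the correction for sampling without replacement. On
the event it is at least \<open>8 ^ (k |T|)\<close>.
\<close>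

lemma depleted_set_count:
  assumes k: "0 < k" and T: "T \<subseteq> {..<n}" "2 * card T \<le> n" and B: "64 * B \<le> n * k" and n: "0 < n"
  shows "real (card {f. f permutes {..<n * k} \<and> k * card T < 2 * card {h. h < B \<and> f h div k \<in> T}})
    \<le> fact (n * k) * (1 / 2) ^ (k * card T)"
proof -
  let ?S = "{..<n * k}" and ?H = "half_edges k T"
  define L where "L = k * card T"
  have finT: "finite T" using T finite_subset by blast
  have H: "?H \<subseteq> ?S" "card ?H = L" "finite ?H"
    using half_edges_subset[OF k T(1)] card_half_edges[OF k finT] by (auto simp: L_def)
  have LN: "2 * L \<le> n * k" using T k by (simp add: L_def mult.commute mult.left_commute)
  then have LN': "L < n * k" using n k by (cases "L = 0") auto
  define \<Phi> where "\<Phi> G f = (64::real) ^ card {v \<in> f ` G. v < B}" for G and f :: "nat \<Rightarrow> nat"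
  let ?P = "{f. f permutes ?S}"
  let ?E = "{f. f permutes ?S \<and> L < 2 * card {h. h < B \<and> f h div k \<in> T}}"
  have finP: "finite ?P" by (simp add: finite_permutations)
  have ge: "8 ^ L \<le> \<Phi> ?H (Hilbert_Choice.inv f)" if "f \<in> ?E" for f
  proof -
    have f: "f permutes ?S" using that by simp
    have "{v \<in> Hilbert_Choice.inv f ` ?H. v < B} = {h. h < B \<and> f h div k \<in> T}"
      using permutes_inverses[OF f] by (auto simp: half_edges_def image_iff)
    then have "\<Phi> ?H (Hilbert_Choice.inv f) = 8 ^ (2 * card {h. h < B \<and> f h div k \<in> T})"
      by (simp add: \<Phi>_def power_mult)
    then show ?thesis using that by (auto intro!: power_increasing)
  qed
  have step: "(\<Sum>y\<in>?S - f ` G. \<Phi> (insert h G) (f(h := y))) \<le> 2 * real (n * k) * \<Phi> G f"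
    if G: "G \<subseteq> ?H" "h \<in> ?H - G" for G h f
  proof -
    have finG: "finite G" using G H finite_subset by blast
    have pt: "\<Phi> (insert h G) (f(h := y)) \<le> \<Phi> G f * (1 + 63 * of_bool (y < B))"
      if y: "y \<in> ?S - f ` G" for y
    proof -
      have "(f(h := y)) ` insert h G = insert y (f ` G)" using G(2) by auto
      then have "{v \<in> (f(h := y)) ` insert h G. v < B}
          = (if y < B then insert y {v \<in> f ` G. v < B} else {v \<in> f ` G. v < B})"
        by auto
      then show ?thesis using y finG by (simp add: \<Phi>_def)
    qed
    have "(\<Sum>y\<in>?S - f ` G. \<Phi> (insert h G) (f(h := y)))
        \<le> (\<Sum>y\<in>?S - f ` G. \<Phi> G f * (1 + 63 * of_bool (y < B)))" by (intro sum_mono pt)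
    also have "\<dots> \<le> (\<Sum>y\<in>?S. \<Phi> G f * (1 + 63 * of_bool (y < B)))"
      by (intro sum_mono2) (auto simp: \<Phi>_def)
    also have "\<dots> = \<Phi> G f * (real (n * k) + 63 * real (card {y \<in> ?S. y < B}))"
      by (simp add: sum_distrib_left[symmetric] sum.distrib Int_def)
    also have "\<dots> \<le> \<Phi> G f * (2 * real (n * k))"
    proof (intro mult_left_mono)
      have "card {y \<in> ?S. y < B} \<le> card {..<B}" by (intro card_mono) auto
      then have "63 * card {y \<in> ?S. y < B} \<le> n * k" using B by simp
      then show "real (n * k) + 63 * real (card {y \<in> ?S. y < B}) \<le> 2 * real (n * k)"
        by linarith
    qed (simp add: \<Phi>_def)
    finally show ?thesis by (simp add: mult.commute)
  qed
  have "8 ^ L * real (card ?E) = (\<Sum>f\<in>?E. 8 ^ L)" by simp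
  also have "\<dots> \<le> (\<Sum>f\<in>?E. \<Phi> ?H (Hilbert_Choice.inv f))" by (intro sum_mono ge)
  also have "\<dots> \<le> (\<Sum>f\<in>?P. \<Phi> ?H (Hilbert_Choice.inv f))" using finP by (intro sum_mono2) (auto simp: \<Phi>_def)
  also have "\<dots> = (\<Sum>f\<in>?P. \<Phi> ?H f)"
    by (rule sum.reindex_bij_witness[where i = Hilbert_Choice.inv and j = Hilbert_Choice.inv])
      (auto simp: permutes_inv permutes_inv_inv)
  also have "\<dots> \<le> (2 * real (n * k) / real (card ?S - card ?H)) ^ card ?H * (\<Sum>f\<in>?P. \<Phi> {} f)"
  proof (rule perm_potential)
    fix G :: "nat set" and f g :: "nat \<Rightarrow> nat" assume "\<And>a. a \<in> G \<Longrightarrow> f a = g a"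
    then have "f ` G = g ` G" by (intro image_cong) auto
    then show "\<Phi> G f = \<Phi> G g" by (simp add: \<Phi>_def)
  next
    fix G h f assume "G \<subseteq> ?H" "h \<in> ?H - G"
    then show "(\<Sum>y\<in>?S - f ` G. \<Phi> (insert h G) (f(h := y))) \<le> 2 * real (n * k) * \<Phi> G f" by (rule step)
  qed (use H LN' in \<open>auto simp: \<Phi>_def\<close>)
  also have "(\<Sum>f\<in>?P. \<Phi> {} f) = fact (n * k)"
    using card_permutations[of ?S "n * k"] by (simp add: \<Phi>_def)
  also have "(2 * real (n * k) / real (card ?S - card ?H)) ^ card ?H * fact (n * k) \<le> 4 ^ L * fact (n * k)"
  proof (intro mult_right_mono)
    have "2 * real (n * k) / real (n * k - L) \<le> 4"
    proof -
      have "2 * (n * k) \<le> 4 * (n * k - L)" using LN by linarith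
      then have "real (2 * (n * k)) \<le> real (4 * (n * k - L))" unfolding of_nat_le_iff .
      then have "2 * real (n * k) \<le> 4 * real (n * k - L)" by simp
      moreover have "0 < real (n * k - L)" using LN' by (metis of_nat_0_less_iff zero_less_diff)
      ultimately show ?thesis by (simp only: pos_divide_le_eq)
    qed
    then show "(2 * real (n * k) / real (card ?S - card ?H)) ^ card ?H \<le> 4 ^ L"
      unfolding H card_lessThan by (intro power_mono) auto
  qed auto
  finally have "8 ^ L * real (card ?E) \<le> 4 ^ L * fact (n * k)" .
  moreover have "(8::real) ^ L = 4 ^ L * 2 ^ L" by (simp flip: power_mult_distrib)
  ultimately have "2 ^ L * real (card ?E) \<le> fact (n * k)" by (simp add: mult.assoc)
  then show ?thesis by (simp add: L_def field_simps power_one_over)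
qed

section \<open>Anticoncentration of the sum over one random row\<close>

text \<open>
The two-state Markov chain that leaves the state \<open>False\<close> with probability \<open>a\<close> and the state \<open>True\<close>
with probability \<open>b\<close>: \<open>chain a b i z\<close> is the probability that it is in \<open>True\<close> after \<open>i\<close> steps from \<open>z\<close>.
Here \<open>True\<close> will stand for a walk that is away from 0.
\<close>

fun chain :: "real \<Rightarrow> real \<Rightarrow> nat \<Rightarrow> bool \<Rightarrow> real" where
  "chain a b 0 z = of_bool z"
| "chain a b (Suc i) True = chain a b i True - b * (chain a b i True - chain a b i False)"
| "chain a b (Suc i) False = chain a b i False + a * (chain a b i True - chain a b i False)"

lemma chain_gap: "chain a b i True - chain a b i False = (1 - (a + b)) ^ i"
proof (induction i)
  case (Suc i)
  then show ?case by (simp add: algebra_simps)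
qed simp

lemma chain_False: "(a + b) * chain a b i False = a * (1 - (1 - (a + b)) ^ i)"
proof (induction i)
  case (Suc i)
  have "(a + b) * chain a b (Suc i) False
      = (a + b) * chain a b i False + (a + b) * a * (1 - (a + b)) ^ i"
    by (simp add: chain_gap algebra_simps)
  then show ?case unfolding Suc.IH by (simp add: algebra_simps)
qed simp

lemma chain_True: "(a + b) * chain a b i True = a + b * (1 - (a + b)) ^ i"
proof -
  have "chain a b i True = chain a b i False + (1 - (a + b)) ^ i" using chain_gap[of a b i] by simp
  then show ?thesis using chain_False[of a b i] by (simp add: algebra_simps)
qed

lemma chain_bounds:
  assumes "0 \<le> a" "0 \<le> b" "a + b \<le> 1"
  shows "0 \<le> chain a b i z \<and> chain a b i z \<le> 1"
proof -
  have gap: "0 \<le> (1 - (a + b)) ^ i" for i using assms by simp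
  have "0 \<le> chain a b i False \<and> chain a b i True \<le> 1" for i
  proof (induction i)
    case (Suc i)
    have "0 \<le> a * (1 - (a + b)) ^ i" "0 \<le> b * (1 - (a + b)) ^ i"
      by (rule mult_nonneg_nonneg[OF _ gap], rule assms)+
    then show ?case using Suc.IH unfolding chain.simps chain_gap by linarith
  qed simp
  from this[of i] chain_gap[of a b i] gap[of i] show ?thesis by (cases z) auto
qed

text \<open>
Here \<open>P\<close> is the set of the column half-edges drawn so far for the current row. The walk is what the sum
of \<open>x\<close> over the row will be if each of the remaining \<open>d - card P\<close> draws contributes \<open>v\<close>. When \<open>v\<close> is
the dominant value of \<open>x\<close> the walk rarely moves, and after \<open>d\<close> draws it is the sum itself.
\<close>

definition walk :: "nat \<Rightarrow> nat \<Rightarrow> (nat \<Rightarrow> real) \<Rightarrow> real \<Rightarrow> nat set \<Rightarrow> real" where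
  "walk k d x v P = sum x ((\<lambda>y. y div k) ` P) + (real d - real (card P)) * v"

lemma walk_insert:
  assumes "finite P" "y \<notin> P"
  shows "walk k d x v (insert y P)
    = walk k d x v P + (if y div k \<in> (\<lambda>y. y div k) ` P then 0 else x (y div k)) - v"
proof -
  have "sum x ((\<lambda>y. y div k) ` insert y P)
      = sum x ((\<lambda>y. y div k) ` P) + (if y div k \<in> (\<lambda>y. y div k) ` P then 0 else x (y div k))"
    using assms(1) by (simp add: insert_absorb)
  then show ?thesis using assms by (simp add: walk_def algebra_simps)
qed

text \<open>
If the walk enters 0 with probability at most \<open>b\<close> and leaves it with probability at least \<open>a\<close> at every
step, then the two-state chain bounds its probability to end away from 0: this probability is monotone
in the state, since the gap between the two states is a power of \<open>1 - (a + b)\<close>.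
\<close>

lemma walk_drift:
  assumes ab: "0 \<le> a" "0 \<le> b" "a + b \<le> 1" and R: "finite R" "P \<subseteq> R" "card P < d"
    and enter: "walk k d x v P \<noteq> 0 \<Longrightarrow>
      real (card {y \<in> R - P. walk k d x v (insert y P) = 0}) \<le> b * (real (card R) - real (card P))"
    and leave: "walk k d x v P = 0 \<Longrightarrow>
      a * (real (card R) - real (card P)) \<le> real (card {y \<in> R - P. walk k d x v (insert y P) \<noteq> 0})"
  shows "(real (card R) - real (card P)) * chain a b (d - card P) (walk k d x v P \<noteq> 0)
    \<le> (\<Sum>y\<in>R - P. chain a b (d - card (insert y P)) (walk k d x v (insert y P) \<noteq> 0))"
proof -
  define i where "i = d - Suc (card P)"
  have di: "d - card P = Suc i" using R(3) by (simp add: i_def)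
  have finP: "finite P" using R finite_subset by blast
  let ?z = "\<lambda>P. walk k d x v P \<noteq> 0"
  let ?W = "real (card R) - real (card P)"
  let ?F = "chain a b i False"
  define D where "D = chain a b i True - ?F"
  have D: "0 \<le> D" using ab by (simp add: D_def chain_gap)
  define q where "q = real (card {y \<in> R - P. ?z (insert y P)})"
  have W: "real (card (R - P)) = ?W"
    using R finP by (simp add: card_Diff_subset card_mono of_nat_diff)
  have "(\<Sum>y\<in>R - P. chain a b (d - card (insert y P)) (?z (insert y P)))
      = (\<Sum>y\<in>R - P. ?F + D * of_bool (?z (insert y P)))"
  proof (rule sum.cong[OF refl])
    fix y assume "y \<in> R - P"
    then have "d - card (insert y P) = i" using finP by (simp add: i_def)
    then show "chain a b (d - card (insert y P)) (?z (insert y P)) = ?F + D * of_bool (?z (insert y P))"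
      by (cases "?z (insert y P)") (simp_all add: D_def)
  qed
  also have "\<dots> = ?W * ?F + D * q"
    using R(1) by (simp add: sum.distrib W sum_distrib_left[symmetric] q_def Int_def)
  finally have eq: "(\<Sum>y\<in>R - P. chain a b (d - card (insert y P)) (?z (insert y P)))
      = ?W * ?F + D * q" .
  show ?thesis
  proof (cases "?z P")
    case True
    let ?B = "{y \<in> R - P. walk k d x v (insert y P) = 0}"
    have "{y \<in> R - P. ?z (insert y P)} = (R - P) - ?B" by auto
    moreover have "card ((R - P) - ?B) = card (R - P) - card ?B" "card ?B \<le> card (R - P)"
      using R(1) by (auto intro!: card_Diff_subset card_mono)
    ultimately have "q = ?W - real (card ?B)" unfolding q_def W[symmetric] by simp
    then have "(1 - b) * ?W \<le> q" using enter True by (simp add: algebra_simps)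
    then have "D * ((1 - b) * ?W) \<le> D * q" using D by (rule mult_left_mono)
    moreover have "?W * chain a b (Suc i) True = ?W * ?F + D * ((1 - b) * ?W)"
      by (simp add: D_def algebra_simps)
    ultimately show ?thesis using True unfolding eq di by (simp del: chain.simps)
  next
    case False
    then have "D * (a * ?W) \<le> D * q" using D leave by (intro mult_left_mono) (auto simp: q_def)
    moreover have "?W * chain a b (Suc i) False = ?W * ?F + D * (a * ?W)"
      by (simp add: D_def algebra_simps)
    ultimately show ?thesis using False unfolding eq di by (simp del: chain.simps)
  qed
qed

text \<open>
Columns that the row has met already contribute nothing new, but they own at most \<open>k d\<close> half-edges,
which is negligible against a constant fraction of all half-edges.
\<close>

lemma card_fresh_ge:
  assumes "0 < k" "finite R" "P \<subseteq> R" "card P \<le> d"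
  shows "real (card (R \<inter> half_edges k Y)) - real (k * d)
    \<le> real (card {y \<in> R - P. y div k \<notin> (\<lambda>y. y div k) ` P \<and> y div k \<in> Y})"
proof -
  let ?J = "(\<lambda>y. y div k) ` P" and ?A = "{y \<in> R - P. y div k \<notin> (\<lambda>y. y div k) ` P \<and> y div k \<in> Y}"
  have finP: "finite P" using assms finite_subset by blast
  have "R \<inter> half_edges k Y \<subseteq> ?A \<union> half_edges k ?J" by (auto simp: half_edges_def)
  then have "card (R \<inter> half_edges k Y) \<le> card (?A \<union> half_edges k ?J)"
    using assms card_half_edges(1)[OF assms(1), of ?J] finP by (intro card_mono) auto
  also have "\<dots> \<le> card ?A + card (half_edges k ?J)" by (rule card_Un_le)
  also have "card (half_edges k ?J) \<le> k * d"
    using card_half_edges(2)[OF assms(1), of ?J] finP card_image_le[OF finP, of "\<lambda>y. y div k"] assms(4)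
    by simp
  finally show ?thesis by linarith
qed

lemma card_used_le:
  assumes "0 < k" "finite R" "P \<subseteq> R" "card P \<le> d"
  shows "card {y \<in> R. y div k \<in> (\<lambda>y. y div k) ` P} \<le> k * d"
proof -
  let ?J = "(\<lambda>y. y div k) ` P"
  have finP: "finite P" using assms finite_subset by blast
  have "card {y \<in> R. y div k \<in> ?J} \<le> card (half_edges k ?J)"
    using card_half_edges(1)[OF assms(1), of ?J] finP
    by (intro card_mono) (auto simp: half_edges_def)
  also have "\<dots> \<le> k * d"
    using card_half_edges(2)[OF assms(1), of ?J] finP card_image_le[OF finP, of "\<lambda>y. y div k"] assms(4)
    by simp
  finally show ?thesis .
qed

lemma power_one_minus_le:
  fixes S :: real
  assumes "0 \<le> S" "S \<le> 1"
  shows "(1 - S) ^ d * (1 + real d * S) \<le> 1"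
proof -
  have "(1 - S) ^ d * (1 + real d * S) \<le> (1 - S) ^ d * (1 + S) ^ d"
    using assms Bernoulli_inequality[of S d] by (intro mult_left_mono) auto
  also have "\<dots> = (1 - S * S) ^ d" by (simp flip: power_mult_distrib add: algebra_simps)
  also have "\<dots> \<le> 1" using assms by (intro power_le_one) (auto simp: mult_le_one)
  finally show ?thesis .
qed

text \<open>
The draws of a row form the set \<open>P\<close>, out of the remaining half-edges \<open>R\<close>. The function \<open>val\<close> is a lower
bound for the conditional probability, given \<open>P\<close>, that the row will not be orthogonal to \<open>x\<close>: it is 0 on
a complete row that is orthogonal, and on average it does not decrease with a draw.
\<close>

definition good_val :: "nat \<Rightarrow> nat \<Rightarrow> nat set \<Rightarrow> (nat \<Rightarrow> real) \<Rightarrow> (nat set \<Rightarrow> real) \<Rightarrow> bool" where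
  "good_val k d R x val \<longleftrightarrow>
     (\<forall>P. 0 \<le> val P \<and> val P \<le> 1) \<and> 1 / 325 \<le> val {}
   \<and> (\<forall>P. card P = d \<longrightarrow> sum x ((\<lambda>y. y div k) ` P) = 0 \<longrightarrow> val P = 0)
   \<and> (\<forall>P\<subseteq>R. card P < d \<longrightarrow>
        (real (card R) - real (card P)) * val P \<le> (\<Sum>y\<in>R - P. val (insert y P)))"

text \<open>
There are three cases, according to the value that dominates among the remaining half-edges. If it is 0,
the walk with \<open>v = 0\<close> starts at 0, leaves it at a rate of order \<open>1 / d\<close> or more by the hypothesis
\<open>supp\<close>, and returns at a comparable rate. If it is some \<open>v \<noteq> 0\<close>, the walk starts at \<open>d v \<noteq> 0\<close>, and
either it enters 0 at a rate comparable to the rate at which it leaves, or at so low a rate that it most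
likely never moves. If no value dominates, then whatever came before, the last draw alone leaves the sum
away from 0 with probability at least \<open>1 / 3\<close>.
\<close>

lemma row_anticoncentration:
  fixes x :: "nat \<Rightarrow> real"
  assumes kd: "0 < k" "0 < d" and R: "finite R" "n * k \<le> 2 * card R" "card R \<le> n * k"
    and large: "1024 * d\<^sup>2 \<le> n"
    and supp: "n * k \<le> 128 * d * card (R \<inter> half_edges k {j. x j \<noteq> 0})"
  shows "\<exists>val. good_val k d R x val"
proof -
  define W where "W = real (card R)"
  define \<kappa> where "\<kappa> = real (k * d)"
  define w where "w Y = real (card (R \<inter> half_edges k Y))" for Y
  have \<kappa>: "\<kappa> \<ge> real d" "\<kappa> > 0" using kd by (auto simp: \<kappa>_def simp flip: of_nat_mult)
  have W512: "512 * \<kappa> * real d \<le> W"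
  proof -
    have "1024 * (k * d * d) \<le> n * k" using large kd by (simp add: power2_eq_square mult_ac)
    also have "\<dots> \<le> 2 * card R" by (rule R(2))
    finally have "512 * (k * d * d) \<le> card R" by linarith
    then have "real (512 * (k * d * d)) \<le> W" unfolding W_def of_nat_le_iff .
    then show ?thesis by (simp add: \<kappa>_def)
  qed
  have W\<kappa>: "512 * \<kappa> \<le> W"
  proof -
    have "512 * \<kappa> * 1 \<le> 512 * \<kappa> * real d" using kd \<kappa> by (intro mult_left_mono) auto
    then show ?thesis using W512 by simp
  qed
  have W0: "W > 0" using W\<kappa> \<kappa> by simp
  \<comment> \<open>It suffices to give the value v that the walk expects and two rates.\<close>
  have goal: ?thesis
    if ab: "0 \<le> a" "0 \<le> b" "a + b \<le> 1"
      and start: "1 / 325 \<le> chain a b d (walk k d x v {} \<noteq> 0)"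
      and enter: "\<And>P. P \<subseteq> R \<Longrightarrow> card P < d \<Longrightarrow> walk k d x v P \<noteq> 0 \<Longrightarrow>
        real (card {y \<in> R - P. walk k d x v (insert y P) = 0}) \<le> b * (W - real (card P))"
      and leave: "\<And>P. P \<subseteq> R \<Longrightarrow> card P < d \<Longrightarrow> walk k d x v P = 0 \<Longrightarrow>
        a * W \<le> real (card {y \<in> R - P. walk k d x v (insert y P) \<noteq> 0})" for a b v
    unfolding good_val_def
  proof (intro exI[of _ "\<lambda>P. chain a b (d - card P) (walk k d x v P \<noteq> 0)"] conjI allI impI)
    fix P assume P: "P \<subseteq> R" "card P < d"
    have "a * (W - real (card P)) \<le> a * W" using ab by (intro mult_left_mono) auto
    then show "(real (card R) - real (card P)) * chain a b (d - card P) (walk k d x v P \<noteq> 0)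
      \<le> (\<Sum>y\<in>R - P. chain a b (d - card (insert y P)) (walk k d x v (insert y P) \<noteq> 0))"
      using enter[OF P] leave[OF P] by (intro walk_drift ab R(1) P) (force simp: W_def)+
  qed (use start chain_bounds[OF ab] in \<open>auto simp: walk_def\<close>)
  have fresh: "w Y - \<kappa> \<le> real (card {y \<in> R - P. y div k \<notin> (\<lambda>y. y div k) ` P \<and> y div k \<in> Y})"
    if "P \<subseteq> R" "card P < d" for P Y
    using card_fresh_ge[OF kd(1) R(1) that(1), of d Y] that(2) by (simp add: w_def \<kappa>_def)
  have ins: "walk k d x v (insert y P)
    = walk k d x v P + (if y div k \<in> (\<lambda>y. y div k) ` P then 0 else x (y div k)) - v"
    if "P \<subseteq> R" "y \<in> R - P" for P y v
    using walk_insert[of P y k d x v] that R(1) finite_subset by blast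
  let ?T = "{j. x j \<noteq> 0}"
  have leave0: "w ?T - \<kappa> \<le> real (card {y \<in> R - P. walk k d x 0 (insert y P) \<noteq> 0})"
    if P: "P \<subseteq> R" "card P < d" "walk k d x 0 P = 0" for P
  proof -
    have "{y \<in> R - P. y div k \<notin> (\<lambda>y. y div k) ` P \<and> y div k \<in> ?T}
      \<subseteq> {y \<in> R - P. walk k d x 0 (insert y P) \<noteq> 0}" using ins[OF P(1), of _ 0] P(3) by auto
    then have "card {y \<in> R - P. y div k \<notin> (\<lambda>y. y div k) ` P \<and> y div k \<in> ?T}
      \<le> card {y \<in> R - P. walk k d x 0 (insert y P) \<noteq> 0}" using R(1) by (intro card_mono) auto
    then show ?thesis using fresh[OF P(1,2), of ?T] by linarith
  qed
  have WP: "511 / 512 * W \<le> W - real (card P)" if "card P < d" for P :: "nat set"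
    using that \<kappa> W\<kappa> by simp
  have wcompl: "real (card {y \<in> R. x (y div k) = u}) = W - w {j. x j \<noteq> u}" for u
  proof -
    have "{y \<in> R. x (y div k) = u} = R - R \<inter> half_edges k {j. x j \<noteq> u}" by (auto simp: half_edges_def)
    then show ?thesis using R(1) by (simp add: w_def W_def card_Diff_subset of_nat_diff card_mono)
  qed
  consider (zero) "w ?T \<le> 2 / 5 * W" | (dom) v where "v \<noteq> 0" "w {j. x j \<noteq> v} \<le> 2 / 5 * W"
    | (spread) "\<And>v. w {j. x j \<noteq> v} > 2 / 5 * W"
  proof (cases "w ?T \<le> 2 / 5 * W \<or> (\<exists>v. v \<noteq> 0 \<and> w {j. x j \<noteq> v} \<le> 2 / 5 * W)")
    case True
    then show ?thesis using zero dom by blast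
  next
    case False
    have "w {j. x j \<noteq> v} > 2 / 5 * W" for v using False by (cases "v = 0") (auto simp: not_le)
    then show ?thesis by (rule spread)
  qed
  then show ?thesis
  proof cases
    case zero
    have T: "real (n * k) \<le> 128 * real d * w ?T"
    proof -
      have "real (n * k) \<le> real (128 * d * card (R \<inter> half_edges k ?T))"
        using supp unfolding of_nat_le_iff .
      then show ?thesis by (simp add: w_def)
    qed
    have wn: "8 * \<kappa> \<le> w ?T"
    proof -
      have "1024 * (k * d * d) \<le> n * k" using large kd by (simp add: power2_eq_square mult_ac)
      then have "real (1024 * (k * d * d)) \<le> real (n * k)" unfolding of_nat_le_iff .
      then have "128 * real d * (8 * \<kappa>) \<le> 128 * real d * w ?T"
        using T by (simp add: \<kappa>_def mult_ac)
      then show ?thesis using kd by simp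
    qed
    \<comment> \<open>The rates are a = w/2W and b = 2w/W, with sum S: the slack of a factor 2 on either side covers the half-edges used within the row, and keeps the ratio a/S at 1/5.\<close>
    define S where "S = 5 / 2 * w ?T / W"
    have S: "0 < S" "S \<le> 1" using wn \<kappa> zero W0 by (auto simp: S_def field_simps)
    have dS: "1 / 64 \<le> real d * S"
    proof -
      have "W \<le> real (n * k)" using R(3) unfolding W_def of_nat_le_iff .
      then have "W \<le> 128 * real d * w ?T" using T by linarith
      then have "W \<le> 128 * (real d * w ?T)" by (simp only: mult.assoc)
      moreover have "0 \<le> real d * w ?T" using wn \<kappa> by (intro mult_nonneg_nonneg) linarith+
      ultimately have "W / 64 \<le> 5 / 2 * (real d * w ?T)" by linarith
      then show ?thesis using W0 by (simp add: S_def field_simps)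
    qed
    have val: "1 / 325 \<le> chain (S / 5) (4 * S / 5) d False"
    proof -
      have SS: "S / 5 + 4 * S / 5 = S" by simp
      have "S * chain (S / 5) (4 * S / 5) d False = S / 5 * (1 - (1 - S) ^ d)"
        using chain_False[of "S / 5" "4 * S / 5" d] unfolding SS .
      then have c: "chain (S / 5) (4 * S / 5) d False = (1 - (1 - S) ^ d) / 5" using S by simp
      have "(1 - S) ^ d * (65 / 64) \<le> (1 - S) ^ d * (1 + real d * S)"
        using dS S by (intro mult_left_mono) auto
      also have "\<dots> \<le> 1" using S by (intro power_one_minus_le) auto
      finally show ?thesis unfolding c by simp
    qed
    show ?thesis
    proof (rule goal[where v = 0 and a = "S / 5" and b = "4 * S / 5"])
      fix P assume P: "P \<subseteq> R" "card P < d" "walk k d x 0 P = 0"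
      have "S / 5 * W = w ?T / 2" using W0 by (simp add: S_def)
      then show "S / 5 * W \<le> real (card {y \<in> R - P. walk k d x 0 (insert y P) \<noteq> 0})"
        using leave0[OF P] wn \<kappa> by linarith
    next
      fix P assume P: "P \<subseteq> R" "card P < d" "walk k d x 0 P \<noteq> 0"
      have "{y \<in> R - P. walk k d x 0 (insert y P) = 0} \<subseteq> R \<inter> half_edges k ?T"
        using ins[OF P(1), of _ 0] P(3) by (auto simp: half_edges_def split: if_splits)
      then have "real (card {y \<in> R - P. walk k d x 0 (insert y P) = 0}) \<le> w ?T"
        using R(1) by (auto simp: w_def intro: card_mono)
      also have "\<dots> = 4 * S / 5 * (W / 2)" using W0 by (simp add: S_def)
      also have "\<dots> \<le> 4 * S / 5 * (W - real (card P))"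
        using WP[OF P(2)] S W0 by (intro mult_left_mono) auto
      finally show "real (card {y \<in> R - P. walk k d x 0 (insert y P) = 0})
        \<le> 4 * S / 5 * (W - real (card P))" .
    qed (use S val in \<open>auto simp: walk_def\<close>)
  next
    case (dom v)
    let ?Y = "{j. x j \<noteq> v}"
    have start: "walk k d x v {} \<noteq> 0" using dom kd by (simp add: walk_def)
    have leave: "w ?Y - \<kappa> \<le> real (card {y \<in> R - P. walk k d x v (insert y P) \<noteq> 0})"
      if P: "P \<subseteq> R" "card P < d" "walk k d x v P = 0" for P
    proof -
      have "{y \<in> R - P. y div k \<notin> (\<lambda>y. y div k) ` P \<and> y div k \<in> ?Y}
        \<subseteq> {y \<in> R - P. walk k d x v (insert y P) \<noteq> 0}" using ins[OF P(1), of _ v] P(3) by auto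
      then have "card {y \<in> R - P. y div k \<notin> (\<lambda>y. y div k) ` P \<and> y div k \<in> ?Y}
        \<le> card {y \<in> R - P. walk k d x v (insert y P) \<noteq> 0}" using R(1) by (intro card_mono) auto
      then show ?thesis using fresh[OF P(1,2), of ?Y] by linarith
    qed
    have enter: "real (card {y \<in> R - P. walk k d x v (insert y P) = 0}) \<le> w ?Y + \<kappa>"
      if P: "P \<subseteq> R" "card P < d" "walk k d x v P \<noteq> 0" for P
    proof -
      have "{y \<in> R - P. walk k d x v (insert y P) = 0}
        \<subseteq> (R \<inter> half_edges k ?Y) \<union> {y \<in> R. y div k \<in> (\<lambda>y. y div k) ` P}"
        using ins[OF P(1), of _ v] P(3) by (auto simp: half_edges_def split: if_splits)
      then have "card {y \<in> R - P. walk k d x v (insert y P) = 0}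
        \<le> card ((R \<inter> half_edges k ?Y) \<union> {y \<in> R. y div k \<in> (\<lambda>y. y div k) ` P})"
        using R(1) by (intro card_mono) auto
      also have "\<dots> \<le> card (R \<inter> half_edges k ?Y) + card {y \<in> R. y div k \<in> (\<lambda>y. y div k) ` P}"
        by (rule card_Un_le)
      also have "\<dots> \<le> card (R \<inter> half_edges k ?Y) + k * d"
        using card_used_le[OF kd(1) R(1) P(1), of d] P(2) by simp
      finally have "real (card {y \<in> R - P. walk k d x v (insert y P) = 0})
        \<le> real (card (R \<inter> half_edges k ?Y) + k * d)" unfolding of_nat_le_iff .
      then show ?thesis by (simp add: w_def \<kappa>_def)
    qed
    show ?thesis
    proof (cases "4 * \<kappa> \<le> w ?Y")
      case True
      define S where "S = 5 / 2 * w ?Y / W"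
      have S: "0 < S" "S \<le> 1" using True \<kappa> dom(2) W0 by (auto simp: S_def field_simps)
      have val: "1 / 325 \<le> chain (S / 5) (4 * S / 5) d True"
      proof -
        have SS: "S / 5 + 4 * S / 5 = S" by simp
        have "S * chain (S / 5) (4 * S / 5) d True = S / 5 + 4 * S / 5 * (1 - S) ^ d"
          using chain_True[of "S / 5" "4 * S / 5" d] unfolding SS .
        moreover have "0 \<le> 4 * S / 5 * (1 - S) ^ d" using S by simp
        ultimately have "S * (1 / 5) \<le> S * chain (S / 5) (4 * S / 5) d True" by linarith
        then show ?thesis using S by simp
      qed
      show ?thesis
      proof (rule goal[where v = v and a = "S / 5" and b = "4 * S / 5"])
        fix P assume P: "P \<subseteq> R" "card P < d" "walk k d x v P = 0"
        have "S / 5 * W = w ?Y / 2" using W0 by (simp add: S_def)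
        then show "S / 5 * W \<le> real (card {y \<in> R - P. walk k d x v (insert y P) \<noteq> 0})"
          using leave[OF P] True \<kappa> by linarith
      next
        fix P assume P: "P \<subseteq> R" "card P < d" "walk k d x v P \<noteq> 0"
        have "w ?Y + \<kappa> \<le> 5 / 4 * w ?Y" using True by simp
        also have "\<dots> = 4 * S / 5 * (5 / 8 * W)" using W0 by (simp add: S_def)
        also have "\<dots> \<le> 4 * S / 5 * (W - real (card P))"
          using WP[OF P(2)] S W0 by (intro mult_left_mono) auto
        finally show "real (card {y \<in> R - P. walk k d x v (insert y P) = 0})
          \<le> 4 * S / 5 * (W - real (card P))" using enter[OF P] by linarith
      qed (use S val start in auto)
    next
      case False
      define b where "b = 10 * \<kappa> / W"
      have b: "0 < b" "b \<le> 1" using \<kappa> W0 W\<kappa> by (auto simp: b_def field_simps)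
      have db: "real d * b \<le> 1 / 2" using W512 W0 by (simp add: b_def field_simps)
      have val: "1 / 325 \<le> chain 0 b d True"
      proof -
        have "b * chain 0 b d True = b * (1 - b) ^ d" using chain_True[of 0 b d] by simp
        then have "chain 0 b d True = (1 + - b) ^ d" using b by simp
        also have "\<dots> \<ge> 1 + real d * (- b)" using b by (intro Bernoulli_inequality) auto
        finally show ?thesis using db by simp
      qed
      show ?thesis
      proof (rule goal[where v = v and a = 0 and b = b])
        fix P assume P: "P \<subseteq> R" "card P < d" "walk k d x v P \<noteq> 0"
        have "w ?Y + \<kappa> \<le> b * (1 / 2 * W)" using False W0 by (simp add: b_def)
        also have "\<dots> \<le> b * (W - real (card P))"
          using WP[OF P(2)] b W0 by (intro mult_left_mono) auto
        finally show "real (card {y \<in> R - P. walk k d x v (insert y P) = 0})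
          \<le> b * (W - real (card P))" using enter[OF P] by linarith
      qed (use b val start in auto)
    qed
  next
    case spread
    have val: "1 / 325 \<le> chain (1 / 3) (2 / 3) d False"
      using chain_False[of "1 / 3" "2 / 3" d] kd(2) by (simp add: zero_power)
    show ?thesis
    proof (rule goal[where v = 0 and a = "1 / 3" and b = "2 / 3"])
      fix P assume P: "P \<subseteq> R" "card P < d" "walk k d x 0 P = 0"
      show "1 / 3 * W \<le> real (card {y \<in> R - P. walk k d x 0 (insert y P) \<noteq> 0})"
        using leave0[OF P] spread[of 0] W\<kappa> by linarith
    next
      fix P assume P: "P \<subseteq> R" "card P < d" "walk k d x 0 P \<noteq> 0"
      define u where "u = - walk k d x 0 P"
      define c where "c = card {y \<in> R - P. walk k d x 0 (insert y P) = 0}"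
      have "{y \<in> R - P. walk k d x 0 (insert y P) = 0} \<subseteq> {y \<in> R. x (y div k) = u}"
        using ins[OF P(1), of _ 0] P(3) by (auto simp: u_def split: if_splits)
      then have "c \<le> card {y \<in> R. x (y div k) = u}"
        using R(1) unfolding c_def by (intro card_mono) auto
      then have "real c \<le> W - w {j. x j \<noteq> u}" unfolding wcompl[symmetric] by simp
      then have "real c < 3 / 5 * W" using spread[of u] by simp
      also have "\<dots> \<le> 2 / 3 * (511 / 512 * W)" using W0 by simp
      also have "\<dots> \<le> 2 / 3 * (W - real (card P))" using WP[OF P(2)] by (intro mult_left_mono) auto
      finally show "real (card {y \<in> R - P. walk k d x 0 (insert y P) = 0}) \<le> 2 / 3 * (W - real (card P))"
        unfolding c_def by (rule less_imp_le)
    qed (use val in \<open>auto simp: walk_def\<close>)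
  qed
qed

section \<open>The kernel of many random rows\<close>

text \<open>
The functions vanish from \<open>n\<close> on, so that they stand for vectors of length \<open>n\<close>.
\<close>

definition row_kernel :: "nat \<Rightarrow> nat \<Rightarrow> nat \<Rightarrow> (nat \<Rightarrow> nat) \<Rightarrow> nat \<Rightarrow> (nat \<Rightarrow> real) set" where
  "row_kernel n k d f i = {x. (\<forall>j\<ge>n. x j = 0) \<and> (\<forall>i'<i. sum x (row_cols k d f i') = 0)}"

definition remaining :: "nat \<Rightarrow> nat \<Rightarrow> (nat \<Rightarrow> nat) \<Rightarrow> nat \<Rightarrow> nat set" where
  "remaining N d f i = {..<N} - f ` {..<i * d}"

text \<open>
After \<open>i\<close> rows every set of \<open>t\<close> columns still has half of its half-edges. Asking this for sets of size
exactly \<open>t\<close> suffices, since a larger support contains such a set.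
\<close>

definition undepleted :: "nat \<Rightarrow> nat \<Rightarrow> nat \<Rightarrow> nat \<Rightarrow> (nat \<Rightarrow> nat) \<Rightarrow> nat \<Rightarrow> bool" where
  "undepleted t n k d f i \<longleftrightarrow>
     (\<forall>T\<subseteq>{..<n}. card T = t \<longrightarrow> k * t \<le> 2 * card (remaining (n * k) d f i \<inter> half_edges k T))"

definition large_kernel_vector :: "nat \<Rightarrow> nat \<Rightarrow> nat \<Rightarrow> nat \<Rightarrow> (nat \<Rightarrow> nat) \<Rightarrow> nat \<Rightarrow> bool" where
  "large_kernel_vector t n k d f i \<longleftrightarrow> (\<exists>x\<in>row_kernel n k d f i. t \<le> card {j. x j \<noteq> 0})"

lemma row_kernel_Suc:
  "row_kernel n k d f (Suc i) = {x \<in> row_kernel n k d f i. sum x (row_cols k d f i) = 0}"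
  by (auto simp: row_kernel_def less_Suc_eq)

lemma row_kernel_subspace: "fun_subspace (row_kernel n k d f i)"
  by (auto simp: fun_subspace_def row_kernel_def sum.distrib simp flip: sum_distrib_left)

lemma row_kernel_determined: "determines {..<n} (row_kernel n k d f i)"
  unfolding determines_def
proof (intro ballI impI allI)
  fix x j assume "x \<in> row_kernel n k d f i" "\<forall>j\<in>{..<n}. x j = 0"
  then show "x j = 0" by (cases "j < n") (auto simp: row_kernel_def)
qed

lemma row_kernel_antimono: "i \<le> i' \<Longrightarrow> row_kernel n k d f i' \<subseteq> row_kernel n k d f i"
  by (auto simp: row_kernel_def)

lemma large_kernel_vector_antimono:
  "i \<le> i' \<Longrightarrow> large_kernel_vector t n k d f i' \<Longrightarrow> large_kernel_vector t n k d f i"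
  using row_kernel_antimono by (fastforce simp: large_kernel_vector_def)

lemma undepleted_Suc:
  assumes "undepleted t n k d f (Suc i)"
  shows "undepleted t n k d f i"
  unfolding undepleted_def
proof (intro allI impI)
  fix T assume T: "T \<subseteq> {..<n}" "card T = t"
  have "{..<i * d} \<subseteq> {..<Suc i * d}" by auto
  then have "remaining (n * k) d f (Suc i) \<inter> half_edges k T \<subseteq> remaining (n * k) d f i \<inter> half_edges k T"
    by (auto simp: remaining_def)
  then have "card (remaining (n * k) d f (Suc i) \<inter> half_edges k T)
      \<le> card (remaining (n * k) d f i \<inter> half_edges k T)"
    by (intro card_mono) (auto simp: remaining_def)
  moreover have "k * t \<le> 2 * card (remaining (n * k) d f (Suc i) \<inter> half_edges k T)"
    using assms T unfolding undepleted_def by blast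
  ultimately show "k * t \<le> 2 * card (remaining (n * k) d f i \<inter> half_edges k T)" by linarith
qed

lemma row_kernel_cong:
  assumes "\<And>h. h < i * d \<Longrightarrow> f h = g h"
  shows "row_kernel n k d f i = row_kernel n k d g i"
proof -
  have "row_cols k d f i' = row_cols k d g i'" if "i' < i" for i'
    unfolding row_cols_def
  proof (rule image_cong[OF refl])
    fix h assume "h \<in> {i' * d..<i' * d + d}"
    moreover have "Suc i' * d \<le> i * d" using that by (intro mult_le_mono1) simp
    ultimately show "f h div k = g h div k" using assms[of h] by simp
  qed
  then show ?thesis by (auto simp: row_kernel_def)
qed

lemma remaining_cong:
  assumes "\<And>h. h < i * d \<Longrightarrow> f h = g h"
  shows "remaining N d f i = remaining N d g i"
proof -
  have "f ` {..<i * d} = g ` {..<i * d}" using assms by (intro image_cong) auto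
  then show ?thesis by (simp add: remaining_def)
qed

text \<open>
It is at least 1 as long as a kernel vector of large support exists and the half-edges are not
depleted, and both conditions can only be lost in time.
\<close>

definition kernel_potential :: "nat \<Rightarrow> nat \<Rightarrow> nat \<Rightarrow> nat \<Rightarrow> nat \<Rightarrow> (nat \<Rightarrow> nat) \<Rightarrow> real" where
  "kernel_potential t n k d i f =
     (if large_kernel_vector t n k d f i \<and> undepleted t n k d f i
      then 2 ^ fun_dim (row_kernel n k d f i) else 0)"

text \<open>
Fix a kernel vector \<open>X\<close> of large support before the row. With probability at least \<open>1 / 325\<close> the row is
not orthogonal to it, and then the dimension drops and the potential at least halves. The interpolation
\<open>\<Theta> j\<close> between the potentials before and after the row is the conditional expectation bound after \<open>j\<close>
draws; \<open>X\<close> and \<open>V\<close> are chosen as functions of the kernel and of the remaining half-edges only, so that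
they depend only on the values revealed before the row.
\<close>

lemma kernel_potential_step:
  assumes kd: "0 < k" "0 < d" and t: "n \<le> 64 * d * t" and large: "1024 * d\<^sup>2 \<le> n"
    and i: "64 * (Suc i * d) \<le> n * k"
  shows "(\<Sum>f | f permutes {..<n * k}. kernel_potential t n k d (Suc i) f)
       \<le> 649 / 650 * (\<Sum>f | f permutes {..<n * k}. kernel_potential t n k d i f)"
proof -
  let ?S = "{..<n * k}" and ?K = "\<lambda>f. row_kernel n k d f i" and ?R = "\<lambda>f. remaining (n * k) d f i"
  let ?\<Phi> = "kernel_potential t n k d i"
  let ?act = "\<lambda>f. large_kernel_vector t n k d f i \<and> undepleted t n k d f i"
  define X where "X K = (SOME x. x \<in> K \<and> t \<le> card {j. x j \<noteq> 0})" for K :: "(nat \<Rightarrow> real) set"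
  define V where "V f = (SOME val. good_val k d (?R f) (X (?K f)) val)" for f
  define \<Theta> where "\<Theta> j f = ?\<Phi> f * (1 - V f (f ` {i * d..<i * d + j}) / 2)" for j f
  have iN: "Suc i * d \<le> n * k" using i by simp
  have cardR: "card (?R f) = n * k - i * d" if f: "f permutes ?S" for f
  proof -
    have "f ` {..<i * d} \<subseteq> ?S" using permutes_image[OF f] iN by (metis image_mono ivl_subset lessThan_subset_iff
        add_leD2 mult_Suc)
    moreover have "card (f ` {..<i * d}) = i * d"
      using card_image[of f "{..<i * d}"] permutes_inj[OF f] by (simp add: inj_on_subset)
    ultimately show ?thesis by (simp add: remaining_def card_Diff_subset)
  qed
  have X: "X (?K f) \<in> ?K f" "t \<le> card {j. X (?K f) j \<noteq> 0}" if "?act f" for f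
    using someI_ex[of "\<lambda>x. x \<in> ?K f \<and> t \<le> card {j. x j \<noteq> 0}"] that
    by (auto simp: X_def large_kernel_vector_def)
  have V: "good_val k d (?R f) (X (?K f)) (V f)" if f: "f permutes ?S" "?act f" for f
  proof -
    let ?x = "X (?K f)"
    let ?T = "{j. ?x j \<noteq> 0}"
    have T: "?T \<subseteq> {..<n}" using X(1)[OF f(2)] by (auto simp: row_kernel_def) (meson not_le)
    obtain T' where T': "T' \<subseteq> ?T" "card T' = t" using X(2)[OF f(2)] by (meson obtain_subset_with_card_n)
    have "k * t \<le> 2 * card (?R f \<inter> half_edges k T')"
      using f(2) T T' unfolding undepleted_def by blast
    also have "\<dots> \<le> 2 * card (?R f \<inter> half_edges k ?T)"
      using T'(1) by (intro mult_le_mono2 card_mono) (auto simp: half_edges_def remaining_def)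
    finally have kt: "k * t \<le> 2 * card (?R f \<inter> half_edges k ?T)" .
    have "n * k \<le> 64 * d * t * k" using t by (intro mult_le_mono1)
    also have "\<dots> = 64 * d * (k * t)" by simp
    also have "\<dots> \<le> 64 * d * (2 * card (?R f \<inter> half_edges k ?T))" using kt by (rule mult_le_mono2)
    also have "\<dots> = 128 * d * card (?R f \<inter> half_edges k ?T)" by simp
    finally have "n * k \<le> 128 * d * card (?R f \<inter> half_edges k ?T)" .
    moreover have "n * k \<le> 2 * card (?R f)" using i unfolding cardR[OF f(1)] by simp
    ultimately have "\<exists>val. good_val k d (?R f) ?x val"
      using cardR[OF f(1)]
      by (intro row_anticoncentration[OF kd, where n = n] large) (auto simp: remaining_def)
    then show ?thesis unfolding V_def by (rule someI_ex)
  qed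
  have \<Phi>_cong: "?\<Phi> f = ?\<Phi> g" "V f = V g" if "\<And>h. h < i * d \<Longrightarrow> f h = g h" for f g
    using row_kernel_cong[of i d f g n k] remaining_cong[of i d f g "n * k"] that
    by (simp_all add: kernel_potential_def V_def large_kernel_vector_def undepleted_def)
  have \<Theta>_step: "(\<Sum>f | f permutes ?S. \<Theta> (Suc j) f) \<le> 1 * (\<Sum>f | f permutes ?S. \<Theta> j f)" if j: "j < d" for j
  proof (rule perm_step[where H = "{..<i * d + j}" and h = "i * d + j"])
    fix f g :: "nat \<Rightarrow> nat" assume "\<And>a. a \<in> insert (i * d + j) {..<i * d + j} \<Longrightarrow> f a = g a"
    then have eq: "f a = g a" if "a \<le> i * d + j" for a using that by (cases "a = i * d + j") auto
    have "f ` {i * d..<i * d + Suc j} = g ` {i * d..<i * d + Suc j}"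
      using eq by (intro image_cong) auto
    moreover have "?\<Phi> f = ?\<Phi> g" "V f = V g" using eq \<Phi>_cong[of f g] by auto
    ultimately show "\<Theta> (Suc j) f = \<Theta> (Suc j) g" by (simp add: \<Theta>_def)
  next
    fix f assume f: "f permutes ?S"
    let ?P = "f ` {i * d..<i * d + j}"
    have split: "{..<i * d + j} = {..<i * d} \<union> {i * d..<i * d + j}" by auto
    have rem: "?S - f ` {..<i * d + j} = ?R f - ?P" unfolding split by (auto simp: remaining_def)
    have inj: "inj f" using permutes_inj[OF f] .
    have cP: "card ?P = j" using card_image[of f "{i * d..<i * d + j}"] inj by (simp add: inj_on_subset)
    have PR: "?P \<subseteq> ?R f"
    proof -
      have "f h < n * k" if "h < i * d + j" for h
        using permutes_in_image[OF f, of h] that j iN by simp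
      then show ?thesis using inj by (auto simp: remaining_def dest: injD)
    qed
    have upd: "\<Theta> (Suc j) (f(i * d + j := y)) = ?\<Phi> f * (1 - V f (insert y ?P) / 2)" for y
    proof -
      have "(f(i * d + j := y)) ` {i * d..<i * d + Suc j} = insert y ?P" by (auto simp: image_iff less_Suc_eq)
      moreover have "?\<Phi> (f(i * d + j := y)) = ?\<Phi> f" "V (f(i * d + j := y)) = V f"
        by (rule \<Phi>_cong, simp)+
      ultimately show ?thesis by (simp add: \<Theta>_def)
    qed
    have W: "real (card (?R f)) - real (card ?P) = real (card ?S - card {..<i * d + j})"
      using j iN by (simp add: cardR[OF f] cP of_nat_diff)
    have cd: "real (card (?R f - ?P)) = real (card (?R f)) - real (card ?P)"
      using PR by (simp add: card_Diff_subset finite_subset card_mono of_nat_diff remaining_def)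
    show "(\<Sum>y\<in>?S - f ` {..<i * d + j}. \<Theta> (Suc j) (f(i * d + j := y)))
        \<le> 1 * real (card ?S - card {..<i * d + j}) * \<Theta> j f"
    proof (cases "?act f")
      case True
      have "\<forall>P\<subseteq>?R f. card P < d \<longrightarrow>
          (real (card (?R f)) - real (card P)) * V f P \<le> (\<Sum>y\<in>?R f - P. V f (insert y P))"
        using V[OF f True] unfolding good_val_def by (elim conjE)
      then have "(real (card (?R f)) - real (card ?P)) * V f ?P \<le> (\<Sum>y\<in>?R f - ?P. V f (insert y ?P))"
        by (rule allE[of _ ?P]) (use PR cP j in simp)
      then have "(\<Sum>y\<in>?R f - ?P. 1 - V f (insert y ?P) / 2)
          \<le> (real (card (?R f)) - real (card ?P)) * (1 - V f ?P / 2)"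
        by (simp add: sum_subtractf sum_divide_distrib[symmetric] right_diff_distrib cd)
      moreover have "0 \<le> ?\<Phi> f" by (simp add: kernel_potential_def)
      ultimately have "?\<Phi> f * (\<Sum>y\<in>?R f - ?P. 1 - V f (insert y ?P) / 2)
          \<le> ?\<Phi> f * ((real (card (?R f)) - real (card ?P)) * (1 - V f ?P / 2))"
        by (rule mult_left_mono)
      then show ?thesis unfolding rem upd W sum_distrib_left by (simp add: \<Theta>_def mult_ac)
    next
      case False
      then have "?\<Phi> f = 0" by (auto simp: kernel_potential_def)
      then show ?thesis unfolding upd by (simp add: \<Theta>_def)
    qed
  qed (use j iN in auto)
  have "j \<le> d \<Longrightarrow> (\<Sum>f | f permutes ?S. \<Theta> j f) \<le> (\<Sum>f | f permutes ?S. \<Theta> 0 f)" for j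
  proof (induction j)
    case (Suc j)
    then show ?case using \<Theta>_step[of j] by simp
  qed simp
  then have chain: "(\<Sum>f | f permutes ?S. \<Theta> d f) \<le> (\<Sum>f | f permutes ?S. \<Theta> 0 f)" by simp
  have last: "kernel_potential t n k d (Suc i) f \<le> \<Theta> d f" if f: "f permutes ?S" for f
  proof (cases "large_kernel_vector t n k d f (Suc i) \<and> undepleted t n k d f (Suc i)")
    case True
    then have act: "?act f" using large_kernel_vector_antimono[of i "Suc i"] undepleted_Suc by auto
    let ?P = "f ` {i * d..<i * d + d}" and ?x = "X (?K f)"
    have cP: "card ?P = d"
      using card_image[of f "{i * d..<i * d + d}"] permutes_inj[OF f] by (simp add: inj_on_subset)
    have col: "(\<lambda>y. y div k) ` ?P = row_cols k d f i" by (auto simp: row_cols_def)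
    have V01: "0 \<le> V f ?P" "V f ?P \<le> 1" using V[OF f act] unfolding good_val_def by blast+
    have eq: "kernel_potential t n k d (Suc i) f = 2 ^ fun_dim (row_kernel n k d f (Suc i))"
      "?\<Phi> f = 2 ^ fun_dim (?K f)" using True act by (simp_all add: kernel_potential_def)
    show ?thesis
    proof (cases "sum ?x (row_cols k d f i) = 0")
      case zero: True
      have "V f ?P = 0" using V[OF f act] cP zero unfolding good_val_def col[symmetric] by blast
      moreover have "fun_dim (row_kernel n k d f (Suc i)) \<le> fun_dim (?K f)"
        using row_kernel_antimono[of i "Suc i"] row_kernel_determined
        by (intro fun_dim_mono[where F = "{..<n}"]) auto
      ultimately show ?thesis unfolding eq \<Theta>_def by (simp add: eq power_increasing)
    next
      case False
      have "fun_dim (row_kernel n k d f (Suc i)) < fun_dim (?K f)"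
        unfolding row_kernel_Suc
        using fun_dim_kernel_less[OF row_kernel_subspace _ row_kernel_determined X(1)[OF act] False]
        by simp
      then have "(2::real) ^ Suc (fun_dim (row_kernel n k d f (Suc i))) \<le> 2 ^ fun_dim (?K f)"
        by (intro power_increasing) auto
      then have "2 ^ fun_dim (row_kernel n k d f (Suc i)) \<le> (2 ^ fun_dim (?K f) :: real) * (1 / 2)" by simp
      also have "\<dots> \<le> 2 ^ fun_dim (?K f) * (1 - V f ?P / 2)" using V01 by (intro mult_left_mono) auto
      finally show ?thesis unfolding eq \<Theta>_def .
    qed
  next
    case False
    then have "kernel_potential t n k d (Suc i) f = 0" by (auto simp: kernel_potential_def)
    moreover have "0 \<le> \<Theta> d f"
    proof (cases "?act f")
      case True
      then have "V f (f ` {i * d..<i * d + d}) \<le> 1" using V[OF f] unfolding good_val_def by blast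
      then show ?thesis by (simp add: \<Theta>_def kernel_potential_def)
    next
      case False
      then have "?\<Phi> f = 0" unfolding kernel_potential_def by (rule if_not_P)
      then show ?thesis by (simp add: \<Theta>_def)
    qed
    ultimately show ?thesis by simp
  qed
  have first: "\<Theta> 0 f \<le> 649 / 650 * ?\<Phi> f" if f: "f permutes ?S" for f
  proof (cases "?act f")
    case True
    then have "1 / 325 \<le> V f {}" using V[OF f] unfolding good_val_def by blast
    then have "?\<Phi> f * (1 - V f {} / 2) \<le> ?\<Phi> f * (649 / 650)"
      by (intro mult_left_mono) (auto simp: kernel_potential_def)
    then show ?thesis by (simp add: \<Theta>_def mult.commute)
  next
    case False
    then have "?\<Phi> f = 0" unfolding kernel_potential_def by (rule if_not_P)
    then show ?thesis by (simp add: \<Theta>_def)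
  qed
  have "(\<Sum>f | f permutes ?S. kernel_potential t n k d (Suc i) f) \<le> (\<Sum>f | f permutes ?S. \<Theta> d f)"
    using last by (intro sum_mono) auto
  also note chain
  also have "(\<Sum>f | f permutes ?S. \<Theta> 0 f) \<le> (\<Sum>f | f permutes ?S. 649 / 650 * ?\<Phi> f)"
    using first by (intro sum_mono) auto
  finally show ?thesis by (simp add: sum_distrib_left)
qed

text \<open>
The initial potential is at most \<open>2 ^ n\<close>, as \<open>n\<close> coordinates determine everything.
\<close>

lemma large_kernel_vector_count:
  assumes kd: "0 < k" "0 < d" and t: "n \<le> 64 * d * t" and large: "1024 * d\<^sup>2 \<le> n"
    and M: "64 * (M * d) \<le> n * k"
  shows "real (card {f. f permutes {..<n * k} \<and> large_kernel_vector t n k d f M \<and> undepleted t n k d f M})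
    \<le> fact (n * k) * (2 ^ n * (649 / 650) ^ M)"
proof -
  let ?P = "{f. f permutes {..<n * k}}"
  let ?E = "{f. f permutes {..<n * k} \<and> large_kernel_vector t n k d f M \<and> undepleted t n k d f M}"
  have fin: "finite ?P" by (simp add: finite_permutations)
  have "i \<le> M \<Longrightarrow> (\<Sum>f\<in>?P. kernel_potential t n k d i f)
      \<le> (649 / 650) ^ i * (\<Sum>f\<in>?P. kernel_potential t n k d 0 f)" for i
  proof (induction i)
    case (Suc i)
    have "Suc i * d \<le> M * d" using Suc(2) by (rule mult_le_mono1)
    then have "64 * (Suc i * d) \<le> n * k" using M by linarith
    from kernel_potential_step[OF kd t large this] Suc show ?case by simp
  qed simp
  then have iter: "(\<Sum>f\<in>?P. kernel_potential t n k d M f)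
      \<le> (649 / 650) ^ M * (\<Sum>f\<in>?P. kernel_potential t n k d 0 f)" by simp
  have "real (card ?E) = (\<Sum>f\<in>?E. 1)" by simp
  also have "\<dots> \<le> (\<Sum>f\<in>?E. kernel_potential t n k d M f)"
    by (intro sum_mono) (auto simp: kernel_potential_def)
  also have "\<dots> \<le> (\<Sum>f\<in>?P. kernel_potential t n k d M f)"
    using fin by (intro sum_mono2) (auto simp: kernel_potential_def)
  also note iter
  also have "(\<Sum>f\<in>?P. kernel_potential t n k d 0 f) \<le> (\<Sum>f\<in>?P. 2 ^ n)"
  proof (rule sum_mono)
    fix f
    have "fun_dim (row_kernel n k d f 0) \<le> n"
      using fun_dim_le[OF _ row_kernel_determined[of n k d f 0]] by simp
    then show "kernel_potential t n k d 0 f \<le> 2 ^ n"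
      by (simp add: kernel_potential_def power_increasing)
  qed
  also have "(\<Sum>f\<in>?P. (2::real) ^ n) = fact (n * k) * 2 ^ n"
    using card_permutations[of "{..<n * k}" "n * k"] by simp
  finally show ?thesis by (simp add: mult_ac)
qed

section \<open>From the residual to kernel vectors\<close>

lemma row_cols_subset:
  assumes f: "f permutes {..<n * k}" and "0 < k" "0 < d" "r * d = n * k" "i < r"
  shows "row_cols k d f i \<subseteq> {..<n}"
proof -
  have "Suc i * d \<le> r * d" using assms by (intro mult_le_mono1) simp
  then have "f h div k < n" if "h \<in> {i * d..<i * d + d}" for h
    using permutes_in_image[OF f, of h] that assms by (simp add: div_less_iff_less_mult)
  then show ?thesis by (auto simp: row_cols_def)
qed

lemma min_residual_le_row_kernel:
  assumes f: "f permutes {..<n * k}" and kd: "0 < k" "0 < d" and N: "r * d = n * k" and m: "m \<le> r"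
  obtains x where "x \<in> row_kernel n k d f m"
    and "min_residual (transpose_mat (first_rows m (abc_matrix r n d k f))) \<le> real (card {j. x j \<noteq> 0})"
proof -
  let ?A = "transpose_mat (first_rows m (abc_matrix r n d k f))"
  have dims: "dim_row ?A = n" "dim_col ?A = m" by (simp_all add: first_rows_def abc_matrix_def)
  have entry: "?A $$ (j, i) = of_bool (j \<in> row_cols k d f i)" if "j < n" "i < m" for i j
  proof -
    have "h < r * d \<and> h div d = i \<longleftrightarrow> h \<in> {i * d..<i * d + d}" for h
      using that m kd mem_row_range[OF kd(2), of h i] by (auto simp: div_less_iff_less_mult[symmetric])
    then have "(\<exists>h<r * d. h div d = i \<and> f h div k = j) \<longleftrightarrow> (\<exists>h. h \<in> {i * d..<i * d + d} \<and> f h div k = j)"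
      by blast
    also have "\<dots> \<longleftrightarrow> j \<in> row_cols k d f i" by (auto simp: row_cols_def)
    finally have "(\<exists>h<r * d. h div d = i \<and> f h div k = j) \<longleftrightarrow> j \<in> row_cols k d f i" .
    then show ?thesis using that m by (simp add: first_rows_def abc_matrix_def)
  qed
  obtain x where x: "\<And>j. j < dim_col ?A \<Longrightarrow> (\<Sum>i<dim_row ?A. x i * ?A $$ (i, j)) = 0"
    "\<And>i. i \<ge> dim_row ?A \<Longrightarrow> x i = 0" "min_residual ?A \<le> real (card {i. x i \<noteq> 0})"
    using min_residual_le_support[of ?A] by blast
  have "sum x (row_cols k d f i) = 0" if i: "i < m" for i
  proof -
    have sub: "row_cols k d f i \<subseteq> {..<n}" using row_cols_subset[OF f kd N] i m by simp
    have "(\<Sum>j<n. x j * ?A $$ (j, i)) = (\<Sum>j<n. if j \<in> row_cols k d f i then x j else 0)"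
      using entry i by (intro sum.cong) auto
    also have "\<dots> = sum x (row_cols k d f i)"
      using sub by (subst sum.inter_restrict[symmetric]) (auto simp: Int_absorb1)
    finally show ?thesis using x(1)[of i] i unfolding dims by simp
  qed
  then have "x \<in> row_kernel n k d f m" using x(2) unfolding dims by (auto simp: row_kernel_def)
  then show ?thesis using that x(3) by blast
qed

lemma kernel_support_stopping:
  assumes "x \<in> row_kernel n k d f m" "i < m"
  shows "card (row_cols k d f i \<inter> {j. x j \<noteq> 0}) \<noteq> 1"
proof
  assume "card (row_cols k d f i \<inter> {j. x j \<noteq> 0}) = 1"
  then obtain c where c: "row_cols k d f i \<inter> {j. x j \<noteq> 0} = {c}" using card_1_singletonE by blast
  have "sum x (row_cols k d f i) = sum x (row_cols k d f i \<inter> {j. x j \<noteq> 0})"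
    by (intro sum.mono_neutral_right) (auto simp: row_cols_def)
  then have "x c = 0" using assms c by (simp add: row_kernel_def)
  then show False using c by auto
qed

lemma undepletedI:
  assumes f: "f permutes {..<n * k}" and k: "0 < k" and Md: "M * d \<le> n * k"
    and few: "\<And>T. T \<subseteq> {..<n} \<Longrightarrow> card T = t \<Longrightarrow> 2 * card {h. h < M * d \<and> f h div k \<in> T} \<le> k * t"
  shows "undepleted t n k d f M"
  unfolding undepleted_def
proof (intro allI impI)
  fix T assume T: "T \<subseteq> {..<n}" "card T = t"
  let ?U = "{h. h < M * d \<and> f h div k \<in> T}" and ?R = "remaining (n * k) d f M \<inter> half_edges k T"
  have finT: "finite T" using T finite_subset by blast
  have "half_edges k T \<subseteq> ?R \<union> f ` ?U"
    using half_edges_subset[OF k T(1)] by (auto simp: remaining_def half_edges_def)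
  then have "card (half_edges k T) \<le> card (?R \<union> f ` ?U)"
    by (intro card_mono) (auto simp: remaining_def)
  also have "\<dots> \<le> card ?R + card (f ` ?U)" by (rule card_Un_le)
  also have "\<dots> \<le> card ?R + card ?U" by (intro add_left_mono card_image_le) auto
  finally have "k * t \<le> card ?R + card ?U" using card_half_edges[OF k finT] T by simp
  then show "k * t \<le> 2 * card ?R" using few[OF T] by linarith
qed

section \<open>Estimates for the union bounds\<close>

text \<open>
From \<open>t ^ t / fact t \<le> exp t\<close>, a term of the exponential series.
\<close>

lemma binomial_le_exp:
  assumes "0 < t"
  shows "real (n choose t) \<le> (exp 1 * real n / real t) ^ t"
proof -
  have pos: "real t ^ t > 0" using assms by simp
  have "(real t) ^ t / fact t \<le> (\<Sum>i. (real t) ^ i / fact i)"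
    using summable_exp[of "real t"] sum_le_suminf[of "\<lambda>i. (real t) ^ i / fact i" "{t}"]
    by (simp add: divide_inverse mult.commute)
  also have "\<dots> = exp (real t)" by (simp add: exp_def divide_inverse mult.commute)
  also have "\<dots> = exp 1 ^ t" by (simp flip: exp_of_nat_mult)
  finally have "1 / fact t \<le> exp 1 ^ t / real t ^ t" using pos by (simp add: field_simps)
  then have "real n ^ t * (1 / fact t) \<le> real n ^ t * (exp 1 ^ t / real t ^ t)" by (intro mult_left_mono) auto
  moreover have "real (n choose t) \<le> real n ^ t / fact t"
  proof -
    have "fact t * (n choose t) \<le> n ^ t" by (metis binomial_fact_pow mult.commute)
    then have "real (fact t * (n choose t)) \<le> real (n ^ t)" unfolding of_nat_le_iff .
    then show ?thesis by (simp add: field_simps)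
  qed
  ultimately show ?thesis by (simp add: power_divide power_mult_distrib mult.commute)
qed

text \<open>
The union bound over stopping sets, per element of the set. For \<open>\<theta> \<ge> 1 / k ^ 3\<close> the base is at most
\<open>4 / 5\<close>, and its \<open>k\<close>-th power beats \<open>1 / \<theta>\<close>. For smaller \<open>\<theta>\<close> the base is within a factor
\<open>1 + O(1 / k)\<close> of \<open>p\<close>, so its \<open>k\<close>-th power is \<open>p ^ k\<close> up to a constant, and \<open>\<theta> \<ge> k p ^ k\<close> leaves a
factor \<open>k\<close> to spare.
\<close>

lemma stopping_rate:
  fixes p \<theta> :: real
  assumes p: "0 < p" "p < 1 / 2" and \<theta>: "0 < \<theta>" "\<theta> * real d \<le> 1 / 64" "p ^ k * real k \<le> \<theta>"
    and dk: "0 < d" "d \<le> k"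
    and k2: "exp 1 * real k ^ 3 * (4 / 5) ^ k \<le> 1 / 2" and k3: "2 * exp (3 + 2 / p) \<le> real k"
  shows "exp 1 / \<theta> * ((p + 2 * sqrt (\<theta> * real d)) / (1 - \<theta>)) ^ k \<le> 1 / 2"
proof -
  let ?B = "(p + 2 * sqrt (\<theta> * real d)) / (1 - \<theta>)"
  have k0: "0 < real k" using dk by simp
  have "\<theta> * 1 \<le> \<theta> * real d" using \<theta>(1) dk by (intro mult_left_mono) auto
  then have \<theta>64: "\<theta> \<le> 1 / 64" using \<theta>(2) by simp
  have B0: "0 \<le> ?B" using p \<theta> \<theta>64 by (intro divide_nonneg_pos) auto
  show ?thesis
  proof (cases "1 / real k ^ 3 \<le> \<theta>")
    case True
    have "sqrt (\<theta> * real d) \<le> sqrt ((1 / 8)\<^sup>2)" using \<theta>(2) by (intro real_sqrt_le_mono) (simp add: power2_eq_square)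
    then have s: "sqrt (\<theta> * real d) \<le> 1 / 8" by simp
    have "?B \<le> 4 / 5" using s p \<theta>64 by (simp add: divide_le_eq)
    then have "?B ^ k \<le> (4 / 5) ^ k" using B0 by (intro power_mono) auto
    moreover have "exp 1 / \<theta> \<le> exp 1 * real k ^ 3" using True \<theta>(1) k0 by (simp add: field_simps)
    ultimately have "exp 1 / \<theta> * ?B ^ k \<le> exp 1 * real k ^ 3 * (4 / 5) ^ k"
      using \<theta>(1) B0 by (intro mult_mono zero_le_power) auto
    then show ?thesis using k2 by linarith
  next
    case False
    have k1: "1 \<le> real k" using dk by simp
    have \<theta>k3: "\<theta> \<le> 1 / real k ^ 3" using False by simp
    have "\<theta> * real d \<le> 1 / real k ^ 3 * real k" using \<theta>k3 dk \<theta>(1) by (intro mult_mono) auto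
    also have "\<dots> = (1 / real k)\<^sup>2" using k0 by (simp add: power2_eq_square power3_eq_cube field_simps)
    finally have "sqrt (\<theta> * real d) \<le> sqrt ((1 / real k)\<^sup>2)" by (rule real_sqrt_le_mono)
    then have s: "sqrt (\<theta> * real d) \<le> 1 / real k" using k0 by simp
    have "1 / real k ^ 3 \<le> 1 / real k"
      using k1 power_increasing[of 1 3 "real k"] by (intro divide_left_mono) auto
    then have \<theta>k: "\<theta> \<le> 1 / real k" using \<theta>k3 by linarith
    have inv: "1 / (1 - \<theta>) \<le> 1 + 2 * \<theta>"
    proof -
      have "1 \<le> (1 + 2 * \<theta>) * (1 - \<theta>)" using \<theta>(1) \<theta>64 mult_left_mono[of "2 * \<theta>" 1 \<theta>] by (simp add: algebra_simps)
      then show ?thesis using \<theta>64 by (simp add: divide_le_eq)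
    qed
    have "?B = (p + 2 * sqrt (\<theta> * real d)) * (1 / (1 - \<theta>))" by simp
    also have "\<dots> \<le> (p * exp (2 / (p * real k))) * exp (2 / real k)"
    proof (intro mult_mono)
      have "p + 2 * sqrt (\<theta> * real d) \<le> p * (1 + 2 / (p * real k))" using s p k0 by (simp add: field_simps)
      also have "\<dots> \<le> p * exp (2 / (p * real k))" using p exp_ge_add_one_self by (intro mult_left_mono) auto
      finally show "p + 2 * sqrt (\<theta> * real d) \<le> p * exp (2 / (p * real k))" .
      have "1 / (1 - \<theta>) \<le> 1 + 2 / real k" using inv \<theta>k by simp
      also have "\<dots> \<le> exp (2 / real k)" by (rule exp_ge_add_one_self)
      finally show "1 / (1 - \<theta>) \<le> exp (2 / real k)" .
    qed (use p \<theta>64 in auto)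
    finally have "?B ^ k \<le> ((p * exp (2 / (p * real k))) * exp (2 / real k)) ^ k"
      using B0 by (intro power_mono)
    also have "\<dots> = p ^ k * exp (2 / p + 2)"
    proof -
      have "exp (2 / (p * real k)) ^ k = exp (2 / p)" "exp (2 / real k) ^ k = exp 2"
        using k0 p by (simp_all flip: exp_of_nat_mult)
      then show ?thesis by (simp add: power_mult_distrib exp_add)
    qed
    finally have Bk: "?B ^ k \<le> p ^ k * exp (2 / p + 2)" .
    have "exp 1 / \<theta> * ?B ^ k \<le> exp 1 / (p ^ k * real k) * (p ^ k * exp (2 / p + 2))"
      using Bk \<theta> p k0 B0 by (intro mult_mono divide_left_mono) auto
    also have "\<dots> = exp (3 + 2 / p) / real k"
    proof -
      have "exp (3 + 2 / p) = exp 1 * exp (2 / p + 2)" by (simp add: add.commute flip: exp_add)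
      then show ?thesis using p k0 by simp
    qed
    also have "\<dots> \<le> 1 / 2" using k3 k0 by (simp add: field_simps)
    finally show ?thesis .
  qed
qed

text \<open>
The choice \<open>s = sqrt (\<theta> d)\<close> balances the terms \<open>k t d / s\<close> and \<open>N s\<close> of \<open>stopping_set_count\<close>.
\<close>

lemma stopping_term:
  fixes p :: real
  assumes p: "0 < p" "p < 1 / 2" and t: "0 < t" "64 * d * t \<le> n" "real n * (p ^ k * real k) \<le> real t"
    and dk: "0 < d" "d \<le> k" and md: "real (m * d) = (1 - p) * real (n * k)"
    and k2: "exp 1 * real k ^ 3 * (4 / 5) ^ k \<le> 1 / 2" and k3: "2 * exp (3 + 2 / p) \<le> real k"
  shows "real (n choose t) * (((real (n * k) - real (m * d)) + real (k * t) * real d / sqrt (real t / real n * real d)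
      + real (n * k) * sqrt (real t / real n * real d)) / real (n * k - k * t)) ^ (k * t) \<le> (1 / 2) ^ t"
proof -
  define \<theta> where "\<theta> = real t / real n"
  define s where "s = sqrt (\<theta> * real d)"
  have dt: "0 < 64 * d * t" using t(1) dk(1) by simp
  have n: "0 < n" using t(2) dt by linarith
  have \<theta>0: "0 < \<theta>" using t n by (simp add: \<theta>_def)
  have tn: "t < n"
  proof -
    have "t * 2 \<le> t * (64 * d)" using dk by (intro mult_le_mono2) auto
    also have "\<dots> = 64 * d * t" by simp
    finally show ?thesis using t(1,2) by linarith
  qed
  have \<theta>d: "\<theta> * real d \<le> 1 / 64"
  proof -
    have "real (64 * d * t) \<le> real n" using t(2) unfolding of_nat_le_iff .
    then show ?thesis using n by (simp add: \<theta>_def field_simps)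
  qed
  have \<theta>p: "p ^ k * real k \<le> \<theta>" using t(3) n by (simp add: \<theta>_def field_simps)
  have s0: "0 < s" using \<theta>0 dk by (simp add: s_def)
  have ss: "s * s = \<theta> * real d" using \<theta>0 by (simp add: s_def)
  have N: "0 < real (n * k)" using n dk by simp
  have a: "real (k * t) * real d / s = real (n * k) * s"
  proof -
    have "real (k * t) * real d = real (n * k) * (\<theta> * real d)" using n by (simp add: \<theta>_def)
    also have "\<dots> = real (n * k) * s * s" using ss by simp
    finally have "real (k * t) * real d = real (n * k) * s * s" .
    moreover have "s \<noteq> 0" using s0 by simp
    ultimately show ?thesis by (simp only: nonzero_divide_eq_eq) simp
  qed
  have b: "real (n * k - k * t) = real (n * k) * (1 - \<theta>)"
  proof -
    have "k * t \<le> n * k" using tn by simp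
    then have "real (n * k - k * t) = real (n * k) - real (k * t)" by (rule of_nat_diff)
    also have "\<dots> = real (n * k) * (1 - \<theta>)" using n by (simp add: \<theta>_def right_diff_distrib)
    finally show ?thesis .
  qed
  have "((real (n * k) - real (m * d)) + real (k * t) * real d / s + real (n * k) * s) / real (n * k - k * t)
      = (real (n * k) * (p + 2 * s)) / (real (n * k) * (1 - \<theta>))"
    unfolding a b md by (simp add: algebra_simps)
  also have "\<dots> = (p + 2 * s) / (1 - \<theta>)" using n dk by auto
  finally have base: "((real (n * k) - real (m * d)) + real (k * t) * real d / s + real (n * k) * s) / real (n * k - k * t)
      = (p + 2 * s) / (1 - \<theta>)" .
  have B0: "0 \<le> (p + 2 * s) / (1 - \<theta>)"
    using p s0 tn n by (intro divide_nonneg_pos) (auto simp: \<theta>_def)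
  have "real (n choose t) * ((p + 2 * s) / (1 - \<theta>)) ^ (k * t)
      \<le> (exp 1 / \<theta>) ^ t * (((p + 2 * s) / (1 - \<theta>)) ^ k) ^ t"
    unfolding power_mult[symmetric] using binomial_le_exp[OF t(1), of n] B0
    by (intro mult_right_mono) (auto simp: \<theta>_def)
  also have "\<dots> = (exp 1 / \<theta> * ((p + 2 * s) / (1 - \<theta>)) ^ k) ^ t" by (simp only: power_mult_distrib)
  also have "\<dots> \<le> (1 / 2) ^ t"
    using stopping_rate[OF p \<theta>0 \<theta>d \<theta>p dk k2 k3] \<theta>0 B0 unfolding s_def by (intro power_mono) auto
  finally show ?thesis unfolding \<theta>_def[symmetric] s_def[symmetric] base .
qed

lemma depletion_term:
  assumes t: "0 < t" "n \<le> 64 * d * t" and dk: "d \<le> k"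
    and k1: "64 * exp 1 * real k * (1 / 2) ^ k \<le> 1 / 2"
  shows "real (n choose t) * (1 / 2) ^ (k * t) \<le> (1 / 2) ^ t"
proof -
  have "n \<le> 64 * k * t" using t(2) dk by (meson le_trans mult_le_mono1 mult_le_mono2)
  then have "real n \<le> real (64 * k * t)" unfolding of_nat_le_iff .
  then have le: "exp 1 * real n / real t \<le> 64 * exp 1 * real k" using t(1) by (simp add: field_simps)
  have "real (n choose t) * (1 / 2) ^ (k * t) \<le> (exp 1 * real n / real t) ^ t * ((1 / 2) ^ k) ^ t"
    unfolding power_mult[symmetric] using binomial_le_exp[OF t(1)] by (intro mult_right_mono) auto
  also have "\<dots> \<le> (64 * exp 1 * real k) ^ t * ((1 / 2) ^ k) ^ t"
    using le by (intro mult_right_mono power_mono) auto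
  also have "\<dots> = (64 * exp 1 * real k * (1 / 2) ^ k) ^ t" by (simp only: power_mult_distrib)
  also have "\<dots> \<le> (1 / 2) ^ t" using k1 by (intro power_mono) auto
  finally show ?thesis .
qed

lemma kernel_term: "(2::real) ^ n * (649 / 650) ^ (1300 * n) \<le> (1 / 2) ^ n"
proof -
  have "(649 / 650 :: real) ^ 650 \<le> 1 / 2"
    using power_one_minus_le[of "1 / 650" 650] by simp
  then have "((649 / 650 :: real) ^ 650) ^ 2 \<le> (1 / 2) ^ 2" by (intro power_mono) auto
  then have "(649 / 650 :: real) ^ 1300 \<le> 1 / 4" by (simp add: power2_eq_square flip: power_mult)
  then have "((649 / 650 :: real) ^ 1300) ^ n \<le> (1 / 4) ^ n" by (intro power_mono) auto
  then have "(2::real) ^ n * (649 / 650) ^ (1300 * n) \<le> 2 ^ n * (1 / 4) ^ n"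
    unfolding power_mult by (intro mult_left_mono) auto
  also have "\<dots> = (1 / 2) ^ n" by (simp flip: power_mult_distrib)
  finally show ?thesis .
qed

section \<open>Bad pairings are rare\<close>

text \<open>
A bad pairing depletes some set of columns, or keeps a kernel vector of large support without depletion,
or has a stopping set of intermediate size. The constant \<open>83200 = 64 * 1300\<close> makes the \<open>1300 n\<close> exposed rows
at most a fraction \<open>1 / 64\<close> of all rows; 1300 is large enough for \<open>2 * (649 / 650) ^ 1300 \<le> 1 / 2\<close>.
\<close>

lemma bad_pairings_count:
  fixes p :: real
  assumes p: "0 < p" "p < 1 / 2" and dk: "0 < d" "83200 * d \<le> k" and N: "r * d = n * k"
    and m: "real m = (1 - p) * real r" and n: "1024 * d\<^sup>2 \<le> n"
    and k1: "64 * exp 1 * real k * (1 / 2) ^ k \<le> 1 / 2"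
    and k2: "exp 1 * real k ^ 3 * (4 / 5) ^ k \<le> 1 / 2" and k3: "2 * exp (3 + 2 / p) \<le> real k"
  shows "real (card {f. f permutes {..<n * k} \<and>
      \<not> min_residual (transpose_mat (first_rows m (abc_matrix r n d k f))) \<le> real n * (p ^ k * real k)})
    \<le> fact (n * k) * ((1 / 2) powr (real n / (64 * real d)) + (1 / 2) ^ n
        + real n * (1 / 2) powr (real n * (p ^ k * real k)))"
proof -
  define t\<^sub>0 where "t\<^sub>0 = Suc (n div (64 * d))"
  define b where "b = real n * (p ^ k * real k)"
  define M where "M = 1300 * n"
  let ?P = "{f. f permutes {..<n * k}}"
  let ?stop = "\<lambda>T f. \<forall>i<m. card (row_cols k d f i \<inter> T) \<noteq> 1"
  define E1 where "E1 T = {f. f permutes {..<n * k} \<and> k * card T < 2 * card {h. h < M * d \<and> f h div k \<in> T}}" for T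
  define E2 where "E2 = {f. f permutes {..<n * k} \<and> large_kernel_vector t\<^sub>0 n k d f M \<and> undepleted t\<^sub>0 n k d f M}"
  define E3 where "E3 T = {f. f permutes {..<n * k} \<and> ?stop T f}" for T
  define \<T>1 where "\<T>1 = {T. T \<subseteq> {..<n} \<and> card T = t\<^sub>0}"
  define \<T>3 where "\<T>3 t = {T. T \<subseteq> {..<n} \<and> card T = t}" for t
  define I where "I = {t. b < real t \<and> t < t\<^sub>0}"
  have k0: "0 < k" "d \<le> k" using dk by auto
  have d1: "1 \<le> d\<^sup>2" using dk by simp
  have n1024: "1024 \<le> n" using n d1 by linarith
  have t0: "0 < t\<^sub>0" "n \<le> 64 * d * t\<^sub>0" "2 * t\<^sub>0 \<le> n"
  proof -
    show "0 < t\<^sub>0" by (simp add: t\<^sub>0_def)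
    have "n < 64 * d + 64 * d * (n div (64 * d))" using dk by (intro dividend_less_times_div) simp
    then show "n \<le> 64 * d * t\<^sub>0" by (simp add: t\<^sub>0_def)
    have "n div (64 * d) \<le> n div 64" using dk by (intro div_le_mono2) auto
    then show "2 * t\<^sub>0 \<le> n" using n1024 by (simp add: t\<^sub>0_def)
  qed
  have small: "64 * d * t \<le> n" if "t < t\<^sub>0" for t
  proof -
    have "64 * d * t \<le> 64 * d * (n div (64 * d))" using that by (intro mult_le_mono2) (simp add: t\<^sub>0_def)
    also have "\<dots> \<le> n" by simp
    finally show ?thesis .
  qed
  have M: "64 * (M * d) \<le> n * k"
  proof -
    have "64 * (M * d) = n * (83200 * d)" by (simp add: M_def)
    then show ?thesis using dk by simp
  qed
  have "(1 - p) * real r \<le> 1 * real r" using p by (intro mult_right_mono) auto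
  then have mr: "m \<le> r" using m by simp
  have md: "real (m * d) = (1 - p) * real (n * k)" using m N by (metis mult.assoc of_nat_mult)
  have Mm: "M \<le> m"
  proof -
    have "64 * M * d \<le> r * d" using M N by simp
    then have "64 * M \<le> r" using dk by simp
    then have "real (64 * M) \<le> real r" unfolding of_nat_le_iff .
    moreover have "1 / 2 * real r \<le> (1 - p) * real r" using p by (intro mult_right_mono) auto
    ultimately have "real M \<le> real m" using m by simp
    then show ?thesis by simp
  qed
  have mdN: "m * d \<le> n * k" using mr N by (metis mult_le_mono1)
  have cover: "{f. f permutes {..<n * k} \<and>
      \<not> min_residual (transpose_mat (first_rows m (abc_matrix r n d k f))) \<le> b}
    \<subseteq> (\<Union>T\<in>\<T>1. E1 T) \<union> E2 \<union> (\<Union>t\<in>I. \<Union>T\<in>\<T>3 t. E3 T)"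
  proof
    fix f assume "f \<in> {f. f permutes {..<n * k} \<and>
      \<not> min_residual (transpose_mat (first_rows m (abc_matrix r n d k f))) \<le> b}"
    then have f: "f permutes {..<n * k}"
      and bad: "b < min_residual (transpose_mat (first_rows m (abc_matrix r n d k f)))" by auto
    obtain x where x: "x \<in> row_kernel n k d f m"
      "min_residual (transpose_mat (first_rows m (abc_matrix r n d k f))) \<le> real (card {j. x j \<noteq> 0})"
      using min_residual_le_row_kernel[OF f k0(1) dk(1) N mr] by blast
    let ?T = "{j. x j \<noteq> 0}"
    show "f \<in> (\<Union>T\<in>\<T>1. E1 T) \<union> E2 \<union> (\<Union>t\<in>I. \<Union>T\<in>\<T>3 t. E3 T)"
    proof (rule ccontr)
      assume no: "f \<notin> (\<Union>T\<in>\<T>1. E1 T) \<union> E2 \<union> (\<Union>t\<in>I. \<Union>T\<in>\<T>3 t. E3 T)"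
      have "undepleted t\<^sub>0 n k d f M"
      proof (rule undepletedI[OF f k0(1)])
        show "M * d \<le> n * k" using M by linarith
        fix T assume T: "T \<subseteq> {..<n}" "card T = t\<^sub>0"
        then have "f \<notin> E1 T" using no by (auto simp: \<T>1_def)
        then show "2 * card {h. h < M * d \<and> f h div k \<in> T} \<le> k * t\<^sub>0"
          using f T by (auto simp: E1_def)
      qed
      then have "\<not> large_kernel_vector t\<^sub>0 n k d f M" using no f by (auto simp: E2_def)
      then have "\<not> large_kernel_vector t\<^sub>0 n k d f m" using large_kernel_vector_antimono[OF Mm] by blast
      then have lt: "card ?T < t\<^sub>0" using x(1) by (auto simp: large_kernel_vector_def not_le)
      have "?T \<subseteq> {..<n}" using x(1) by (auto simp: row_kernel_def) (meson not_le)
      then have "?T \<in> \<T>3 (card ?T)" by (simp add: \<T>3_def)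
      moreover have "card ?T \<in> I" using lt bad x(2) by (simp add: I_def)
      moreover have "f \<in> E3 ?T" using f kernel_support_stopping[OF x(1)] by (simp add: E3_def)
      ultimately show False using no by blast
    qed
  qed
  have finI: "finite I" by (rule finite_subset[of _ "{..<t\<^sub>0}"]) (auto simp: I_def)
  have finT: "finite (\<T>3 t)" for t unfolding \<T>3_def by (rule finite_subset[of _ "Pow {..<n}"]) auto
  have finT1: "finite \<T>1" unfolding \<T>1_def by (rule finite_subset[of _ "Pow {..<n}"]) auto
  have finE: "finite (E1 T)" "finite E2" "finite (E3 T)" for T
    by (auto simp: E1_def E2_def E3_def intro: finite_subset[OF _ finite_permutations[of "{..<n * k}"]])
  have cT1: "card \<T>1 = n choose t\<^sub>0" using n_subsets[of "{..<n}" t\<^sub>0] by (simp add: \<T>1_def)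
  have cT3: "card (\<T>3 t) = n choose t" for t using n_subsets[of "{..<n}" t] by (simp add: \<T>3_def)
  have c1: "real (\<Sum>T\<in>\<T>1. card (E1 T)) \<le> fact (n * k) * (1 / 2) powr (real n / (64 * real d))"
  proof -
    have "real (\<Sum>T\<in>\<T>1. card (E1 T)) \<le> (\<Sum>T\<in>\<T>1. fact (n * k) * (1 / 2) ^ (k * t\<^sub>0))"
      unfolding of_nat_sum
    proof (rule sum_mono)
      fix T assume "T \<in> \<T>1"
      then have T: "T \<subseteq> {..<n}" "card T = t\<^sub>0" by (auto simp: \<T>1_def)
      show "real (card (E1 T)) \<le> fact (n * k) * (1 / 2) ^ (k * t\<^sub>0)"
        using depleted_set_count[OF k0(1) T(1), of "M * d"] T(2) t0(3) M n1024 unfolding E1_def by simp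
    qed
    also have "\<dots> = fact (n * k) * (real (n choose t\<^sub>0) * (1 / 2) ^ (k * t\<^sub>0))" by (simp add: cT1)
    also have "\<dots> \<le> fact (n * k) * (1 / 2) ^ t\<^sub>0"
      using depletion_term[OF t0(1,2) k0(2) k1] by (intro mult_left_mono) auto
    also have "\<dots> = fact (n * k) * (1 / 2) powr (real t\<^sub>0)" by (simp add: powr_realpow)
    also have "\<dots> \<le> fact (n * k) * (1 / 2) powr (real n / (64 * real d))"
    proof (intro mult_left_mono powr_mono')
      have "real n \<le> real (64 * d * t\<^sub>0)" using t0(2) unfolding of_nat_le_iff .
      then show "real n / (64 * real d) \<le> real t\<^sub>0" using dk by (simp add: divide_le_eq mult_ac)
    qed auto
    finally show ?thesis .
  qed
  have c2: "real (card E2) \<le> fact (n * k) * (1 / 2) ^ n"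
  proof -
    have "real (card E2) \<le> fact (n * k) * (2 ^ n * (649 / 650) ^ M)"
      unfolding E2_def by (rule large_kernel_vector_count[OF k0(1) dk(1) t0(2) n M])
    also have "\<dots> \<le> fact (n * k) * (1 / 2) ^ n"
      unfolding M_def by (intro mult_left_mono kernel_term) auto
    finally show ?thesis .
  qed
  have c3: "real (\<Sum>t\<in>I. \<Sum>T\<in>\<T>3 t. card (E3 T)) \<le> fact (n * k) * (real n * (1 / 2) powr b)"
  proof -
    have b0: "0 \<le> b" using p by (simp add: b_def)
    have one: "real (\<Sum>T\<in>\<T>3 t. card (E3 T)) \<le> fact (n * k) * (1 / 2) powr b" if t: "t \<in> I" for t
    proof -
      let ?s = "sqrt (real t / real n * real d)"
      let ?w = "(((real (n * k) - real (m * d)) + real (k * t) * real d / ?s + real (n * k) * ?s)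
          / real (n * k - k * t)) ^ (k * t)"
      have t': "0 < t" "64 * d * t \<le> n" "real n * (p ^ k * real k) \<le> real t" "b \<le> real t"
        using t b0 small[of t] by (auto simp: I_def b_def)
      have s: "0 < ?s" "?s \<le> 1"
      proof -
        show "0 < ?s" using t' n1024 dk by simp
        have "t * d \<le> n" using t'(2) by (simp add: mult_ac)
        then have "real (t * d) \<le> real n" unfolding of_nat_le_iff .
        then show "?s \<le> 1" using n1024 by (simp add: divide_le_eq)
      qed
      have tn: "t < n" using t t0(3) n1024 by (simp add: I_def)
      have "real (\<Sum>T\<in>\<T>3 t. card (E3 T)) \<le> (\<Sum>T\<in>\<T>3 t. fact (n * k) * ?w)"
        unfolding of_nat_sum
      proof (rule sum_mono)
        fix T assume "T \<in> \<T>3 t"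
        then have T: "T \<subseteq> {..<n}" "card T = t" by (auto simp: \<T>3_def)
        show "real (card (E3 T)) \<le> fact (n * k) * ?w"
          using stopping_set_count[OF k0(1) dk(1) s T(1) _ mdN] T(2) tn unfolding E3_def by simp
      qed
      also have "\<dots> = fact (n * k) * (real (n choose t) * ?w)" by (simp add: cT3)
      also have "\<dots> \<le> fact (n * k) * (1 / 2) ^ t"
        using stopping_term[OF p t'(1,2,3) dk(1) k0(2) md k2 k3] by (intro mult_left_mono) auto
      also have "\<dots> = fact (n * k) * (1 / 2) powr (real t)" by (simp add: powr_realpow)
      also have "\<dots> \<le> fact (n * k) * (1 / 2) powr b"
        using t'(4) by (intro mult_left_mono powr_mono') auto
      finally show ?thesis .
    qed
    have "card I \<le> card {..<t\<^sub>0}" by (intro card_mono) (auto simp: I_def)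
    then have cI: "real (card I) \<le> real n" using t0(3) by simp
    have "real (\<Sum>t\<in>I. \<Sum>T\<in>\<T>3 t. card (E3 T)) = (\<Sum>t\<in>I. real (\<Sum>T\<in>\<T>3 t. card (E3 T)))" by (rule of_nat_sum)
    also have "\<dots> \<le> (\<Sum>t\<in>I. fact (n * k) * (1 / 2) powr b)" by (intro sum_mono one)
    also have "\<dots> = fact (n * k) * (real (card I) * (1 / 2) powr b)" by simp
    also have "\<dots> \<le> fact (n * k) * (real n * (1 / 2) powr b)"
      using cI by (intro mult_left_mono mult_right_mono) auto
    finally show ?thesis .
  qed
  have "card {f. f permutes {..<n * k} \<and>
      \<not> min_residual (transpose_mat (first_rows m (abc_matrix r n d k f))) \<le> b}
    \<le> card ((\<Union>T\<in>\<T>1. E1 T) \<union> E2 \<union> (\<Union>t\<in>I. \<Union>T\<in>\<T>3 t. E3 T))"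
    using finI finT finT1 finE by (intro card_mono[OF _ cover]) auto
  also have "\<dots> \<le> card (\<Union>T\<in>\<T>1. E1 T) + card E2 + card (\<Union>t\<in>I. \<Union>T\<in>\<T>3 t. E3 T)"
    by (intro order_trans[OF card_Un_le] add_right_mono card_Un_le)
  also have "\<dots> \<le> (\<Sum>T\<in>\<T>1. card (E1 T)) + card E2 + (\<Sum>t\<in>I. \<Sum>T\<in>\<T>3 t. card (E3 T))"
    using finI finT finT1
    by (intro add_mono order_refl card_UN_le order_trans[OF card_UN_le[OF finI] sum_mono])
  finally have "real (card {f. f permutes {..<n * k} \<and>
      \<not> min_residual (transpose_mat (first_rows m (abc_matrix r n d k f))) \<le> b})
    \<le> real ((\<Sum>T\<in>\<T>1. card (E1 T)) + card E2 + (\<Sum>t\<in>I. \<Sum>T\<in>\<T>3 t. card (E3 T)))"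
    unfolding of_nat_le_iff .
  also have "\<dots> \<le> fact (n * k) * (1 / 2) powr (real n / (64 * real d)) + fact (n * k) * (1 / 2) ^ n
      + fact (n * k) * (real n * (1 / 2) powr b)"
    unfolding of_nat_add by (intro add_mono c1 c2 c3)
  finally show ?thesis by (simp add: b_def distrib_left)
qed

lemma ABC_p_prob_ge:
  fixes p \<gamma> :: real
  assumes p: "0 < p" "p < 1 / 2" and d: "0 < d" and \<gamma>: "83200 \<le> \<gamma>" and k: "real k = \<gamma> * real d"
    and params: "ABC_params p n \<gamma> d" and n: "1024 * d\<^sup>2 \<le> n"
    and k1: "64 * exp 1 * real k * (1 / 2) ^ k \<le> 1 / 2"
    and k2: "exp 1 * real k ^ 3 * (4 / 5) ^ k \<le> 1 / 2" and k3: "2 * exp (3 + 2 / p) \<le> real k"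
  shows "1 - ((1 / 2) powr (real n / (64 * real d)) + (1 / 2) ^ n
        + real n * (1 / 2) powr (real n * (p ^ k * real k)))
    \<le> measure_pmf.prob (map_pmf transpose_mat (ABC_p p n \<gamma> d))
        {A. 1 / real n * min_residual A \<le> p powr (\<gamma> * real d + 1 * log p (\<gamma> * real d))}"
proof -
  obtain r m where r: "real r = \<gamma> * real n" and m: "real m = \<gamma> * real n * (1 - p)"
    using params unfolding ABC_params_def Nats_def by (metis imageE)
  have rm: "nat \<lfloor>\<gamma> * real n\<rfloor> = r" "nat \<lfloor>\<gamma> * real d\<rfloor> = k" "nat \<lfloor>\<gamma> * real n * (1 - p)\<rfloor> = m"
  proof -
    show "nat \<lfloor>\<gamma> * real n\<rfloor> = r" unfolding r[symmetric] by simp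
    show "nat \<lfloor>\<gamma> * real d\<rfloor> = k" unfolding k[symmetric] by simp
    show "nat \<lfloor>\<gamma> * real n * (1 - p)\<rfloor> = m" unfolding m[symmetric] by simp
  qed
  have "real (r * d) = real (n * k)" using r k by simp
  then have N: "r * d = n * k" unfolding of_nat_eq_iff .
  have "real (83200 * d) \<le> real k" using \<gamma> d unfolding k by (simp add: mult_right_mono)
  then have dk: "83200 * d \<le> k" unfolding of_nat_le_iff .
  then have k0: "0 < k" using d by linarith
  have n0: "0 < n"
  proof -
    have "1 \<le> d\<^sup>2" using d by simp
    then show ?thesis using n by linarith
  qed
  define q where "q = p ^ k * real k"
  have target: "p powr (\<gamma> * real d + 1 * log p (\<gamma> * real d)) = q"
    using p k0 by (simp add: q_def powr_add powr_realpow flip: k)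
  let ?P = "{f. f permutes {..<n * k}}"
  let ?A = "\<lambda>f. transpose_mat (first_rows m (abc_matrix r n d k f))"
  let ?good = "{f. min_residual (?A f) \<le> real n * q}"
  have finP: "finite ?P" by (simp add: finite_permutations)
  have neP: "?P \<noteq> {}" using permutes_id by blast
  have cP: "real (card ?P) = fact (n * k)" using card_permutations[of "{..<n * k}" "n * k"] by simp
  define err where "err = (1 / 2) powr (real n / (64 * real d)) + (1 / 2) ^ n + real n * (1 / 2) powr (real n * q)"
  define bad where "bad = {f. f permutes {..<n * k} \<and> \<not> min_residual (?A f) \<le> real n * q}"
  have mr: "real m = (1 - p) * real r" using r m by (simp add: mult.commute)
  have bad_le: "real (card bad) \<le> fact (n * k) * err"
    unfolding bad_def q_def err_def by (rule bad_pairings_count[OF p d dk N mr n k1 k2 k3])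
  have "card ?P = card (bad \<union> (?P \<inter> ?good))"
    by (rule arg_cong[of _ _ card]) (auto simp: bad_def)
  also have "\<dots> \<le> card bad + card (?P \<inter> ?good)" by (rule card_Un_le)
  finally have "real (card ?P) \<le> real (card bad + card (?P \<inter> ?good))" unfolding of_nat_le_iff .
  then have "fact (n * k) * (1 - err) \<le> real (card (?P \<inter> ?good))"
    using bad_le unfolding cP of_nat_add right_diff_distrib by linarith
  then have "1 - err \<le> real (card (?P \<inter> ?good)) / real (card ?P)"
    unfolding cP by (simp add: pos_le_divide_eq mult.commute)
  also have "\<dots> = measure_pmf.prob (pmf_of_set ?P) ?good"
    by (rule measure_pmf_of_set[OF neP finP, symmetric])
  also have "?good = ?A -` {A. 1 / real n * min_residual A \<le> q}"
    using n0 by (auto simp: field_simps)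
  also have "measure_pmf.prob (pmf_of_set ?P) \<dots>
      = measure_pmf.prob (map_pmf ?A (pmf_of_set ?P)) {A. 1 / real n * min_residual A \<le> q}"
    by simp
  also have "map_pmf ?A (pmf_of_set ?P) = map_pmf transpose_mat (ABC_p p n \<gamma> d)"
    by (simp add: ABC_p_def ABC_def rm N pmf.map_comp o_def)
  finally show ?thesis unfolding target err_def q_def .
qed

theorem corollary8p6:
  fixes p :: real
  assumes "0 < p" and "p < 1 / 2"
  shows "\<exists>(c :: real) (\<gamma>\<^sub>0 :: real) (d\<^sub>0 :: nat). \<forall>(\<gamma> :: real) (d :: nat).
           \<gamma> \<ge> \<gamma>\<^sub>0 \<longrightarrow> d \<ge> d\<^sub>0 \<longrightarrow>
           ((\<lambda>n :: nat. measure_pmf.prob (map_pmf transpose_mat (ABC_p p n \<gamma> d))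
               {A. 1 / real n * min_residual A
                     \<le> p powr (\<gamma> * real d + c * log p (\<gamma> * real d))})
             \<longlongrightarrow> 1) (at_top \<sqinter> principal {n. ABC_params p n \<gamma> d})"
proof -
  have "eventually (\<lambda>k :: nat. 64 * exp 1 * real k * (1 / 2) ^ k \<le> 1 / 2) at_top" by real_asymp
  moreover have "eventually (\<lambda>k :: nat. exp 1 * real k ^ 3 * (4 / 5) ^ k \<le> 1 / 2) at_top" by real_asymp
  moreover have "eventually (\<lambda>k :: nat. 2 * exp (3 + 2 / p) \<le> real k) at_top"
    using filterlim_real_sequentially unfolding filterlim_at_top by blast
  ultimately have "eventually (\<lambda>k :: nat. 64 * exp 1 * real k * (1 / 2) ^ k \<le> 1 / 2
      \<and> exp 1 * real k ^ 3 * (4 / 5) ^ k \<le> 1 / 2 \<and> 2 * exp (3 + 2 / p) \<le> real k) at_top"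
    by eventually_elim simp
  then obtain k\<^sub>0 where k\<^sub>0: "\<And>k :: nat. k \<ge> k\<^sub>0 \<Longrightarrow> 64 * exp 1 * real k * (1 / 2) ^ k \<le> 1 / 2
      \<and> exp 1 * real k ^ 3 * (4 / 5) ^ k \<le> 1 / 2 \<and> 2 * exp (3 + 2 / p) \<le> real k"
    unfolding eventually_at_top_linorder by blast
  show ?thesis
  proof (rule exI[of _ "1::real"], rule exI[of _ "max 83200 (real k\<^sub>0)"], rule exI[of _ "1::nat"], intro allI impI)
    fix \<gamma> :: real and d :: nat
    assume \<gamma>: "max 83200 (real k\<^sub>0) \<le> \<gamma>" and d: "1 \<le> d"
    let ?F = "at_top \<sqinter> principal {n. ABC_params p n \<gamma> d}"
    let ?pr = "\<lambda>n. measure_pmf.prob (map_pmf transpose_mat (ABC_p p n \<gamma> d))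
        {A. 1 / real n * min_residual A \<le> p powr (\<gamma> * real d + 1 * log p (\<gamma> * real d))}"
    show "(?pr \<longlongrightarrow> 1) ?F"
    \<comment> \<open>If the column degree is not an integer, no n is admissible and the filter is trivial.\<close>
    proof (cases "\<gamma> * real d \<in> \<nat>")
      case False
      then have "\<not> ABC_params p n \<gamma> d" for n by (simp add: ABC_params_def)
      then show ?thesis by simp
    next
      case True
      then obtain k where k: "real k = \<gamma> * real d" unfolding Nats_def by (metis imageE)
      have "real k\<^sub>0 * 1 \<le> \<gamma> * real d" using \<gamma> d by (intro mult_mono) auto
      then have kk: "k\<^sub>0 \<le> k" using k by simp
      have kpos: "0 < real k" using \<gamma> d unfolding k by simp
      define a where "a = 1 / (64 * real d)"
      define c where "c = p ^ k * real k"
      have ac: "0 < a" "0 < c" using d kpos assms by (auto simp: a_def c_def)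
      let ?lower = "\<lambda>n. 1 - ((1 / 2) powr (real n / (64 * real d)) + (1 / 2) ^ n
        + real n * (1 / 2) powr (real n * (p ^ k * real k)))"
      have half: "(1 / 2 :: real) powr y = exp (- (ln 2 * y))" for y by (simp add: powr_def ln_div)
      define a' where "a' = ln 2 * a"
      define c' where "c' = ln 2 * c"
      have ac': "0 < a'" "0 < c'" using ac by (auto simp: a'_def c'_def)
      have "((\<lambda>n :: nat. exp (- (a' * real n))) \<longlongrightarrow> 0) at_top"
        "((\<lambda>n :: nat. (1 / 2 :: real) ^ n) \<longlongrightarrow> 0) at_top"
        "((\<lambda>n :: nat. real n * exp (- (c' * real n))) \<longlongrightarrow> 0) at_top"
        using ac' by real_asymp+
      from tendsto_diff[OF tendsto_const[of 1] tendsto_add[OF tendsto_add[OF this(1,2)] this(3)]]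
      have "((\<lambda>n :: nat. 1 - (exp (- (a' * real n)) + (1 / 2) ^ n + real n * exp (- (c' * real n)))) \<longlongrightarrow> 1) at_top"
        by simp
      moreover have "?lower = (\<lambda>n. 1 - (exp (- (a' * real n)) + (1 / 2) ^ n + real n * exp (- (c' * real n))))"
        unfolding half by (simp add: a'_def c'_def a_def c_def mult_ac)
      ultimately have "(?lower \<longlongrightarrow> 1) at_top" by simp
      then have lower: "(?lower \<longlongrightarrow> 1) ?F" by (rule tendsto_mono[OF inf_le1])
      have "eventually (\<lambda>n. ?lower n \<le> ?pr n) ?F"
        unfolding eventually_inf_principal
        using eventually_ge_at_top[of "1024 * d\<^sup>2"]
      proof eventually_elim
        case (elim n)
        then show ?case
          using ABC_p_prob_ge[OF assms _ _ k, of n] k\<^sub>0[OF kk] \<gamma> d by simp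
      qed
      then show ?thesis
        by (rule tendsto_sandwich[OF _ _ lower tendsto_const]) simp
    qed
  qed
qed

end
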